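(* Let $a,b,c,d,e,f,g\in\mathbb{C}$ satisfy $e+f+g-a-b-c-d=1$, and suppose that both sides of the following identity are defined. Then $$L(a,b,c,d;e;f,g)=L(a,b,g-c,g-d;\,1+a+b-f;\,1+a+b-e,\,g).$$
   Context: For complex parameters with no $b_i$ a nonpositive integer, ${}_4F_3\left[{a_1,a_2,a_3,a_4;\atop b_1,b_2,b_3;}1\right]=\sum_{n=0}^{\infty}\frac{(a_1)_n(a_2)_n(a_3)_n(a_4)_n}{n!\,(b_1)_n(b_2)_n(b_3)_n}$, where $(x)_0=1$ and $(x)_n=x(x+1)\cdots(x+n-1)$ for $n>0$. The series converges absolutely if $\mathrm{Re}(b_1+b_2+b_3-a_1-a_2-a_3-a_4)>0$. For $a,b,c,d,e,f,g\in\mathbb{C}$ with $e+f+g-a-b-c-d=1$, define $$L(a,b,c,d;e;f,g)=\frac{{}_4F_3\left[{a,b,c,d;\atop e,f,g;}1\right]}{\sin (\pi e)\,\Gamma(e)\Gamma(f)\Gamma(g)\Gamma(1+a-e)\Gamma(1+b-e)\Gamma(1+c-e)\Gamma(1+d-e)}-\frac{{}_4F_3\left[{1+a-e,\,1+b-e,\,1+c-e,\,1+d-e;\atop 1+f-e,\,1+g-e,\,2-e;}1\right]}{\sin (\pi e)\,\Gamma(a)\Gamma(b)\Gamma(c)\Gamma(d)\Gamma(1+f-e)\Gamma(1+g-e)\Gamma(2-e)},$$ where $1/\Gamma$ is regarded as an entire function. $L(a,b,c,d;e;f,g)$ is defined when $e\notin\mathbb{Z}$ and none of $f,\ g,\ 1+f-e,\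 1+g-e$ is a nonpositive integer. (The parameters on the right-hand side of the claim again satisfy the condition that (sum of the last three) minus (sum of the first four) equals $1$.) *)

theory Defs
  imports "HOL-Analysis.Analysis"
begin

text \<open>The generalized hypergeometric series \<open>4F3\<close> at unit argument, as an ordinary infinite sum.
  It is meant for \<open>b1, b2, b3\<close> not in \<open>\<int>\<^sub>\<le>\<^sub>0\<close> and
  \<open>Re (b1 + b2 + b3 - a1 - a2 - a3 - a4) > 0\<close>; elsewhere the value is a junk value.\<close>

definition hyp4F3 ::
  "complex \<Rightarrow> complex \<Rightarrow> complex \<Rightarrow> complex \<Rightarrow> complex \<Rightarrow> complex \<Rightarrow> complex \<Rightarrow> complex" where
  "hyp4F3 a1 a2 a3 a4 b1 b2 b3 =
    (\<Sum>n. (pochhammer a1 n * pochhammer a2 n * pochhammer a3 n * pochhammer a4 n) /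
         (fact n * pochhammer b1 n * pochhammer b2 n * pochhammer b3 n))"

text \<open>\<open>1 / \<Gamma>\<close> is read as the entire function \<^const>\<open>rGamma\<close>, which vanishes on
  \<open>\<int>\<^sub>\<le>\<^sub>0\<close>. The function is only meant to be used for
  \<open>e + f + g - a - b - c - d = 1\<close>, in which case both series have parametric excess \<open>1\<close>
  and hence converge absolutely under the predicate \<open>L_defined\<close> below.\<close>

definition L ::
  "complex \<Rightarrow> complex \<Rightarrow> complex \<Rightarrow> complex \<Rightarrow> complex \<Rightarrow> complex \<Rightarrow> complex \<Rightarrow> complex" where
  "L a b c d e f g =
     hyp4F3 a b c d e f g / sin (of_real pi * e)
       * (rGamma e * rGamma f * rGamma g
          * rGamma (1 + a - e) * rGamma (1 + b - e) * rGamma (1 + c - e) * rGamma (1 + d - e))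
     - hyp4F3 (1 + a - e) (1 + b - e) (1 + c - e) (1 + d - e) (1 + f - e) (1 + g - e) (2 - e)
         / sin (of_real pi * e)
       * (rGamma a * rGamma b * rGamma c * rGamma d
          * rGamma (1 + f - e) * rGamma (1 + g - e) * rGamma (2 - e))"

text \<open>The condition does not involve \<open>a, b, c, d\<close>.\<close>

definition L_defined :: "complex \<Rightarrow> complex \<Rightarrow> complex \<Rightarrow> bool" where
  "L_defined e f g \<longleftrightarrow>
     e \<notin> \<int> \<and> f \<notin> \<int>\<^sub>\<le>\<^sub>0 \<and> g \<notin> \<int>\<^sub>\<le>\<^sub>0 \<and> 1 + f - e \<notin> \<int>\<^sub>\<le>\<^sub>0 \<and> 1 + g - e \<notin> \<int>\<^sub>\<le>\<^sub>0"

end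

theory Submission
  imports Defs "HOL-Complex_Analysis.Complex_Analysis"
begin

text \<open>
  With \<open>\<phi>(t) = \<Gamma>(a+t)\<Gamma>(b+t)\<Gamma>(c+t)\<Gamma>(d+t) / (\<Gamma>(1+t)\<Gamma>(e+t)\<Gamma>(f+t)\<Gamma>(g+t))\<close>, the function \<open>L\<close> is, up to
  reciprocal Gamma factors and \<open>sin (\<pi> e)\<close>, the difference \<open>\<Sum>n. \<phi>(n)\<close> minus \<open>\<Sum>n. \<phi>(n + 1 - e)\<close>.
  Expanding \<open>\<Gamma>(d+t) / (\<Gamma>(f+t)\<Gamma>(g+t))\<close> by Gauss's theorem and summing over \<open>t\<close> by a contiguous
  extension of the nonterminating Saalschuetz theorem turns this difference into a double series
  that is symmetric under exchanging \<open>(a, b)\<close> with \<open>(g - d, f - d)\<close>. This yields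
  \<open>L(a,b,c,d;e;f,g) = L(g-d,f-d,c,1+c-e;1+c-d;f+g-d-a,f+g-d-b)\<close> for suitable parameters. Permuting the
  numerator parameters and applying this a second time gives the claim near the point
  \<open>a = b = c = 1/5\<close>, \<open>d = 3/10\<close>, \<open>e = 9/10\<close>, \<open>f = g = 1/2\<close>. After multiplication by the sines both
  sides are entire on the hyperplane \<open>e + f + g - a - b - c - d = 1\<close>, so the identity extends along
  complex lines through that point.
\<close>

section \<open>Asymptotics of Gamma quotients\<close>

text \<open>The Gauss expansion with index \<open>m\<close> leaves sums over \<open>t\<close> of
  excess \<open>1 + m\<close>, whereas the Saalschuetz theorem needs excess 1. For
  \<open>m > 0\<close> the difference of the two sums is not a product of Gamma values but one more
  3F2, with summation index \<open>k\<close>; this is why a double series appears. With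
  \<open>p = g - d\<close>, \<open>q = f - d\<close>, \<open>y = 1 + a + b - e\<close> its term is,
  up to a constant, \<open>gamma_quot p 1 m * gamma_quot q y m * gamma_quot a 1 k * gamma_quot b y k
  * gamma_quot y (y + c) (m + k)\<close>. Exchanging \<open>(a, b, k)\<close> with
  \<open>(p, q, m)\<close> leaves it unchanged, and \<open>y\<close> has the same value for the
  transformed parameters. The resulting transformation is an involution, so a second use gains
  something only after a permutation of numerator parameters. The base point is fixed by the
  transformation, by its permuted form and by their composition, so that all four tuples involved
  lie in \<open>good_region\<close> as soon as one does. Continuing the pole-free
  \<open>L_reg\<close> instead of \<open>L\<close> avoids any question about connectedness of the
  domain of \<open>L\<close>.\<close>

definition gamma_quot :: "'a::Gamma \<Rightarrow> 'a \<Rightarrow> nat \<Rightarrow> 'a" where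
  "gamma_quot z w n = Gamma (z + of_nat n) * rGamma (w + of_nat n)"

lemma not_nonpos_Ints_if_Re_pos: "Re z > 0 \<Longrightarrow> z \<notin> \<int>\<^sub>\<le>\<^sub>0"
  by (auto elim!: nonpos_Ints_cases')

lemma gamma_quot_of_real: "gamma_quot (complex_of_real x) (of_real y) n = of_real (gamma_quot x y n)"
  unfolding gamma_quot_def
  by (metis Gamma_complex_of_real of_real_add of_real_mult of_real_of_nat_eq rGamma_complex_of_real)

lemma rGamma_real_pos: "x > (0::real) \<Longrightarrow> rGamma x > 0"
  by (simp add: rGamma_inverse_Gamma)

lemma gamma_quot_real_pos: "x > 0 \<Longrightarrow> y > 0 \<Longrightarrow> gamma_quot x y n > (0::real)"
  by (simp add: gamma_quot_def rGamma_real_pos)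

lemma gamma_quot_mult_swap: "gamma_quot z w n * gamma_quot z' w' n = gamma_quot z w' n * gamma_quot z' w n"
  by (simp add: gamma_quot_def)

lemma Gamma_plus1_Re: "Re z > 0 \<Longrightarrow> Gamma (z + 1) = z * Gamma z"
  by (intro Gamma_plus1 not_nonpos_Ints_if_Re_pos)

lemma gamma_quot_plus1_left:
  fixes z w :: complex
  shows "Re z > 0 \<Longrightarrow> gamma_quot (z + 1) w n = (z + of_nat n) * gamma_quot z w n"
  using Gamma_plus1_Re[of "z + of_nat n"] by (simp add: gamma_quot_def add_ac)

lemma gamma_quot_plus1_right: "gamma_quot z w n = (w + of_nat n) * gamma_quot z (w + 1) n"
  using rGamma_plus1[of "w + of_nat n"] by (simp add: gamma_quot_def add_ac mult_ac)

lemma gamma_quot_Suc: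
  fixes z w :: complex
  shows "Re z > 0 \<Longrightarrow> (w + of_nat n) * gamma_quot z w (Suc n) = (z + of_nat n) * gamma_quot z w n"
  using Gamma_plus1_Re[of "z + of_nat n"] rGamma_plus1[of "w + of_nat n"] by (simp add: gamma_quot_def add_ac)

lemma gamma_quot_shift: "gamma_quot (z + of_nat m) (w + of_nat m) n = gamma_quot z w (m + n)"
  by (simp add: gamma_quot_def add_ac)

text \<open>\<open>Gamma_series'\<close> tends to \<open>Gamma\<close>. In the quotient of its
  values at \<open>w\<close> and \<open>z\<close> the factorials cancel, which leaves a quotient of
  Pochhammer symbols times \<open>n\<close> to the power \<open>w - z\<close>.\<close>

lemma gamma_quot_asymp:
  fixes z w :: complex
  assumes "Re z > 0" "Re w > 0"
  shows "(\<lambda>n. gamma_quot z w n * exp ((w - z) * of_real (ln (real n)))) \<longlonglongrightarrow> 1"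
proof -
  have nz: "z \<notin> \<int>\<^sub>\<le>\<^sub>0" "w \<notin> \<int>\<^sub>\<le>\<^sub>0"
    using assms by (auto dest: not_nonpos_Ints_if_Re_pos)
  have nz': "Gamma (z + of_nat n) \<noteq> 0" "Gamma (w + of_nat n) \<noteq> 0" for n
    using assms not_nonpos_Ints_if_Re_pos[of "z + of_nat n"] not_nonpos_Ints_if_Re_pos[of "w + of_nat n"]
    by (auto simp: Gamma_eq_zero_iff)
  have eq: "gamma_quot z w n * exp ((w - z) * of_real (ln (real n))) =
      (Gamma z / Gamma_series' z n) * (Gamma_series' w n / Gamma w)" for n
    using nz nz'[of n] by (simp add: gamma_quot_def Gamma_series'_def pochhammer_Gamma exp_diff
        left_diff_distrib rGamma_inverse_Gamma Gamma_eq_zero_iff field_simps)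
  show ?thesis
    unfolding eq using nz by (auto intro!: tendsto_eq_intros Gamma_series'_LIMSEQ simp: Gamma_eq_zero_iff)
qed

lemma gamma_quot_bigo:
  assumes "Re z > 0" "Re w > 0"
  shows "(\<lambda>n. norm (gamma_quot z w n)) \<in> O(\<lambda>n. real n powr (Re z - Re w))"
proof (rule bigoI_tendsto_norm)
  have *: "norm (exp ((w - z) * of_real (ln (real n)))) = 1 / real n powr (Re z - Re w)" if "n > 0" for n
  proof -
    have "norm (exp ((w - z) * of_real (ln (real n)))) = exp (- ((Re z - Re w) * ln (real n)))"
      by (simp add: norm_exp_eq_Re algebra_simps)
    thus ?thesis
      using that by (simp only: exp_minus) (simp add: powr_def divide_inverse)
  qed
  have lim: "(\<lambda>n. norm (gamma_quot z w n * exp ((w - z) * of_real (ln (real n))))) \<longlonglongrightarrow> norm (1::complex)"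
    by (intro tendsto_norm gamma_quot_asymp assms)
  have ev: "eventually (\<lambda>n. norm (gamma_quot z w n * exp ((w - z) * of_real (ln (real n)))) =
      norm (norm (gamma_quot z w n) / real n powr (Re z - Re w))) sequentially"
    using eventually_gt_at_top[of "0::nat"]
  proof eventually_elim
    case (elim n)
    show ?case unfolding norm_mult *[OF elim] by simp
  qed
  show "(\<lambda>n. norm (norm (gamma_quot z w n) / real n powr (Re z - Re w))) \<longlonglongrightarrow> norm (1::complex)"
    using lim unfolding tendsto_cong[OF ev] .
  show "eventually (\<lambda>n. real n powr (Re z - Re w) \<noteq> 0) sequentially"
    using eventually_gt_at_top[of "0::nat"] by eventually_elim auto
qed

lemma gamma_quot_balanced_tendsto_1:
  fixes p q r s :: complex
  assumes "Re p > 0" "Re q > 0" "Re r > 0" "Re s > 0" "p + q = r + s"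
  shows "(\<lambda>n. gamma_quot p r n * gamma_quot q s n) \<longlonglongrightarrow> 1"
proof -
  have "(\<lambda>n. (gamma_quot p r n * exp ((r - p) * of_real (ln (real n)))) *
             (gamma_quot q s n * exp ((s - q) * of_real (ln (real n))))) \<longlonglongrightarrow> 1 * 1"
    by (intro tendsto_mult gamma_quot_asymp assms)
  also have "(\<lambda>n. (gamma_quot p r n * exp ((r - p) * of_real (ln (real n)))) *
             (gamma_quot q s n * exp ((s - q) * of_real (ln (real n))))) = (\<lambda>n. gamma_quot p r n * gamma_quot q s n)"
  proof
    fix n
    have "exp ((r - p) * of_real (ln (real n))) * exp ((s - q) * of_real (ln (real n))) = 1"
      using assms(5) unfolding exp_add[symmetric] distrib_right[symmetric]
      by (metis (no_types, lifting) add_diff_add diff_self exp_zero mult_zero_left add.commute)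
    thus "(gamma_quot p r n * exp ((r - p) * of_real (ln (real n)))) *
        (gamma_quot q s n * exp ((s - q) * of_real (ln (real n)))) = gamma_quot p r n * gamma_quot q s n"
      by (simp add: mult_ac)
  qed
  finally show ?thesis by simp
qed

section \<open>Comparison of complex Gamma factors with real ones\<close>

lemma gamma_quot_real_bound:
  assumes "Re z > 0" "Re w > 0" "Re z = Re w"
  obtains C where "C > 0" "\<And>n. norm (gamma_quot z w n) \<le> C"
proof -
  have "(\<lambda>n. norm (gamma_quot z w n)) \<in> O(\<lambda>n. real n powr (Re z - Re w))"
    by (rule gamma_quot_bigo) fact+
  also have "(\<lambda>n. real n powr (Re z - Re w)) \<in> O(\<lambda>n. 1)"
    using assms by (intro bigoI[of _ 1]) (auto simp: powr_def)
  finally have "(\<lambda>n. norm (gamma_quot z w n)) \<in> O(\<lambda>n. 1)" .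
  then obtain c where c: "eventually (\<lambda>n. norm (gamma_quot z w n) \<le> c) sequentially"
    by (elim landau_o.bigE) auto
  then have "Bseq (gamma_quot z w)"
    by (rule BfunI)
  thus ?thesis using that by (auto elim: BseqE)
qed

lemma norm_Gamma_shift_le:
  fixes z :: complex
  assumes "Re z > 0"
  obtains C where "C > 0" "\<And>n. norm (Gamma (z + of_nat n)) \<le> C * Gamma (Re z + real n)"
proof -
  obtain C where C: "C > 0" "\<And>n. norm (gamma_quot z (of_real (Re z)) n) \<le> C"
    using gamma_quot_real_bound[of z "of_real (Re z)"] assms by auto
  have "norm (Gamma (z + of_nat n)) \<le> C * Gamma (Re z + real n)" for n
  proof -
    have "norm (rGamma (of_real (Re z) + of_nat n :: complex)) = inverse (Gamma (Re z + real n))"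
      using assms rGamma_complex_of_real[of "Re z + real n"]
      by (simp add: rGamma_inverse_Gamma norm_inverse)
    thus ?thesis
      using C(2)[of n] assms Gamma_real_pos[of "Re z + real n"]
      by (simp add: gamma_quot_def norm_mult field_simps)
  qed
  with C(1) show ?thesis by (rule that)
qed

text \<open>Since |Gamma z| is at most Gamma (Re z), a constant above 1 is in general unavoidable
  here. Together with \<open>norm_Gamma_shift_le\<close> this majorises hypergeometric terms by the
  positive terms that belong to the real parts of the parameters.\<close>

lemma norm_rGamma_shift_le:
  fixes z :: complex
  assumes "Re z > 0"
  obtains C where "C > 0" "\<And>n. norm (rGamma (z + of_nat n)) \<le> C * rGamma (Re z + real n)"
proof -
  obtain C where C: "C > 0" "\<And>n. norm (gamma_quot (of_real (Re z)) z n) \<le> C"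
    using gamma_quot_real_bound[of "of_real (Re z)" z] assms by auto
  have "norm (rGamma (z + of_nat n)) \<le> C * rGamma (Re z + real n)" for n
  proof -
    have "norm (gamma_quot (of_real (Re z)) z n) = Gamma (Re z + real n) * norm (rGamma (z + of_nat n))"
      using assms Gamma_complex_of_real[of "Re z + real n"] by (simp add: gamma_quot_def norm_mult)
    thus ?thesis
      using C(2)[of n] assms Gamma_real_pos[of "Re z + real n"]
      by (simp add: rGamma_inverse_Gamma[of "Re z + real n"] field_simps)
  qed
  with C(1) show ?thesis by (rule that)
qed

section \<open>Absolute convergence and exchange of summations\<close>

lemma summable_gamma_quot2:
  fixes a b c d :: complex
  assumes "Re a > 0" "Re b > 0" "Re c > 0" "Re d > 0" "Re (c + d - a - b) > 1"
  shows "summable (\<lambda>n. norm (gamma_quot a c n * gamma_quot b d n))"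
proof (rule summable_comparison_test_bigo)
  have "(\<lambda>n. norm (gamma_quot a c n) * norm (gamma_quot b d n)) \<in>
      O(\<lambda>n. real n powr (Re a - Re c) * real n powr (Re b - Re d))"
    by (intro landau_o.big_mult gamma_quot_bigo assms)
  thus "(\<lambda>n. norm (gamma_quot a c n * gamma_quot b d n)) \<in> O(\<lambda>n. real n powr (Re (a + b - c - d)))"
    by (simp add: norm_mult powr_add[symmetric] algebra_simps)
  show "summable (\<lambda>n. norm (real n powr Re (a + b - c - d)))"
    using assms by (simp add: summable_real_powr_iff)
qed

lemma summable_gamma_quot3:
  fixes a b c d e f :: complex
  assumes "Re a > 0" "Re b > 0" "Re c > 0" "Re d > 0" "Re e > 0" "Re f > 0"
    and "Re (d + e + f - a - b - c) > 1"
  shows "summable (\<lambda>n. norm (gamma_quot a d n * gamma_quot b e n * gamma_quot c f n))"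
proof (rule summable_comparison_test_bigo)
  have "(\<lambda>n. norm (gamma_quot a d n) * norm (gamma_quot b e n) * norm (gamma_quot c f n)) \<in>
      O(\<lambda>n. real n powr (Re a - Re d) * real n powr (Re b - Re e) * real n powr (Re c - Re f))"
    by (intro landau_o.big_mult gamma_quot_bigo assms)
  thus "(\<lambda>n. norm (gamma_quot a d n * gamma_quot b e n * gamma_quot c f n)) \<in> O(\<lambda>n. real n powr (Re (a + b + c - d - e - f)))"
    by (simp add: norm_mult powr_add[symmetric] algebra_simps)
  show "summable (\<lambda>n. norm (real n powr Re (a + b + c - d - e - f)))"
    using assms by (simp add: summable_real_powr_iff)
qed

lemma summable_gamma_quot4:
  fixes a b c d e f g h :: complex
  assumes "Re a > 0" "Re b > 0" "Re c > 0" "Re d > 0" "Re e > 0" "Re f > 0" "Re g > 0" "Re h > 0"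
    and "Re (e + f + g + h - a - b - c - d) > 1"
  shows "summable (\<lambda>n. norm (gamma_quot a e n * gamma_quot b f n * gamma_quot c g n * gamma_quot d h n))"
proof (rule summable_comparison_test_bigo)
  have "(\<lambda>n. norm (gamma_quot a e n) * norm (gamma_quot b f n) * norm (gamma_quot c g n) * norm (gamma_quot d h n)) \<in>
      O(\<lambda>n. real n powr (Re a - Re e) * real n powr (Re b - Re f) * real n powr (Re c - Re g)
         * real n powr (Re d - Re h))"
    by (intro landau_o.big_mult gamma_quot_bigo assms)
  thus "(\<lambda>n. norm (gamma_quot a e n * gamma_quot b f n * gamma_quot c g n * gamma_quot d h n)) \<in>
      O(\<lambda>n. real n powr (Re (a + b + c + d - e - f - g - h)))"
    by (simp add: norm_mult powr_add[symmetric] algebra_simps)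
  show "summable (\<lambda>n. norm (real n powr Re (a + b + c + d - e - f - g - h)))"
    using assms by (simp add: summable_real_powr_iff)
qed

text \<open>Fubini for iterated \<open>suminf\<close>. The majorant enters through the values
  \<open>G\<close> of its row sums, because for real parameters these come from Gauss's theorem or
  from an iterated sum already known to converge.\<close>

lemma suminf_swap_dominated:
  fixes f :: "nat \<Rightarrow> nat \<Rightarrow> complex" and g :: "nat \<Rightarrow> nat \<Rightarrow> real"
  assumes le: "\<And>m n. norm (f m n) \<le> g m n"
    and g: "\<And>m. g m sums G m" and G: "summable G"
  shows "summable (\<lambda>m. \<Sum>n. f m n)" "summable (\<lambda>n. \<Sum>m. f m n)"
    "(\<Sum>m. \<Sum>n. f m n) = (\<Sum>n. \<Sum>m. f m n)"
    "summable (\<lambda>m. f m n)"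
proof -
  have g0: "g m n \<ge> 0" for m n
    using le[of m n] norm_ge_zero order_trans by blast
  have G0: "G m \<ge> 0" for m
    using g[of m] g0 by (metis sums_le sums_zero)
  have "(\<lambda>(m,n). g m n) summable_on UNIV \<times> UNIV"
    by (rule summable_on_SigmaI[where g = G])
       (use g g0 G G0 in \<open>auto intro!: sums_nonneg_imp_has_sum simp: summable_on_UNIV_nonneg_real_iff\<close>)
  hence "(\<lambda>x. norm (case x of (m,n) \<Rightarrow> f m n)) summable_on UNIV \<times> UNIV"
    by (rule Infinite_Sum.abs_summable_on_comparison_test') (use le in auto)
  hence S: "(\<lambda>(m,n). f m n) summable_on UNIV \<times> UNIV"
    by (rule abs_summable_summable)
  have S': "(\<lambda>(n,m). f m n) summable_on UNIV \<times> UNIV"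
    using S by (subst summable_on_swap) (auto simp: case_prod_unfold)
  have row: "f m summable_on UNIV" for m
    using summable_on_SigmaD1[OF S] by auto
  have col: "(\<lambda>m. f m n) summable_on UNIV" for n
    using summable_on_SigmaD1[OF S'] by auto
  have row': "(\<Sum>n. f m n) = infsum (f m) UNIV" for m
    using has_sum_imp_sums[OF has_sum_infsum[OF row]] by (simp add: sums_iff)
  have col': "(\<Sum>m. f m n) = infsum (\<lambda>m. f m n) UNIV" for n
    using has_sum_imp_sums[OF has_sum_infsum[OF col]] by (simp add: sums_iff)
  have R: "(\<lambda>m. infsum (f m) UNIV) summable_on UNIV"
    using summable_on_Sigma_banach[OF S] by simp
  have C: "(\<lambda>n. infsum (\<lambda>m. f m n) UNIV) summable_on UNIV"
    using summable_on_Sigma_banach[OF S'] by simp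
  show "summable (\<lambda>m. \<Sum>n. f m n)" unfolding row' using R by (rule summable_on_imp_summable)
  show "summable (\<lambda>n. \<Sum>m. f m n)" unfolding col' using C by (rule summable_on_imp_summable)
  show "summable (\<lambda>m. f m n)" using col by (rule summable_on_imp_summable)
  have "(\<Sum>m. \<Sum>n. f m n) = infsum (\<lambda>m. infsum (f m) UNIV) UNIV"
    unfolding row' using has_sum_imp_sums[OF has_sum_infsum[OF R]] by (simp add: sums_iff)
  also have "\<dots> = infsum (\<lambda>n. infsum (\<lambda>m. f m n) UNIV) UNIV"
    using infsum_swap_banach[OF S] by simp
  also have "\<dots> = (\<Sum>n. \<Sum>m. f m n)"
    unfolding col' using has_sum_imp_sums[OF has_sum_infsum[OF C]] by (simp add: sums_iff)
  finally show "(\<Sum>m. \<Sum>n. f m n) = (\<Sum>n. \<Sum>m. f m n)" .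
qed

section \<open>Gauss's summation theorem\<close>

lemma tendsto_0_if_bigo_powr:
  fixes f :: "nat \<Rightarrow> complex"
  assumes "(\<lambda>n. norm (f n)) \<in> O(\<lambda>n. real n powr p)" "p < 0"
  shows "f \<longlonglongrightarrow> 0"
proof -
  obtain C where C: "eventually (\<lambda>n. norm (norm (f n)) \<le> C * norm (real n powr p)) sequentially"
    using assms(1) by (elim landau_o.bigE)
  have "(\<lambda>n. real n powr p) \<longlonglongrightarrow> 0"
    by (rule tendsto_neg_powr[OF assms(2) filterlim_real_sequentially])
  thus ?thesis
    by (rule tendsto_0_le[where K = C]) (use C in \<open>simp add: mult.commute\<close>)
qed

lemma inverse_shift_tendsto_0: "(\<lambda>N. inverse (z + of_nat N :: complex)) \<longlonglongrightarrow> 0"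
  by (intro filterlim_compose[OF tendsto_inverse_0] tendsto_add_filterlim_at_infinity[OF tendsto_const]
      tendsto_of_nat)

lemma inverse_pochhammer_tendsto:
  "(\<lambda>N. inverse (pochhammer (z + of_nat N :: complex) k)) \<longlonglongrightarrow> (if k = 0 then 1 else 0)"
proof (induction k)
  case (Suc k)
  have "(\<lambda>N. inverse (pochhammer (z + of_nat N) k) * inverse ((z + of_nat k) + of_nat N))
          \<longlonglongrightarrow> (if k = 0 then 1 else 0) * 0"
    by (intro tendsto_mult Suc.IH inverse_shift_tendsto_0)
  thus ?case by (simp add: pochhammer_Suc add_ac)
qed auto

lemma pochhammer_quot_tendsto:
  "(\<lambda>N. pochhammer (z + of_nat N) k / pochhammer (w + of_nat N :: complex) k) \<longlonglongrightarrow> 1"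
proof (induction k)
  case (Suc k)
  have "(\<lambda>N. 1 + (z - w) * inverse ((w + of_nat k) + of_nat N)) \<longlonglongrightarrow> 1 + (z - w) * 0"
    by (intro tendsto_intros inverse_shift_tendsto_0)
  moreover have "eventually (\<lambda>N. 1 + (z - w) * inverse ((w + of_nat k) + of_nat N) =
      (z + of_nat N + of_nat k) / (w + of_nat N + of_nat k)) sequentially"
  proof -
    have "eventually (\<lambda>N. norm ((w + of_nat k) + of_nat N) > 0) sequentially"
      using tendsto_add_filterlim_at_infinity[OF tendsto_const tendsto_of_nat, of "w + of_nat k"]
      by (rule filterlim_at_infinity_imp_eventually_ne[THEN eventually_mono, of _ _ 0]) simp
    thus ?thesis by eventually_elim (auto simp: field_simps)
  qed
  ultimately have "(\<lambda>N. (z + of_nat N + of_nat k) / (w + of_nat N + of_nat k)) \<longlonglongrightarrow> 1"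
    by (simp add: tendsto_cong)
  from tendsto_mult[OF Suc.IH this] show ?case by (simp add: pochhammer_Suc)
qed auto

lemma Gamma_shift_eq:
  fixes z :: complex
  shows "Re z > 0 \<Longrightarrow> Gamma (z + of_nat n) = pochhammer z n * Gamma z"
  using pochhammer_Gamma[OF not_nonpos_Ints_if_Re_pos, of z n] not_nonpos_Ints_if_Re_pos[of z]
  by (simp add: Gamma_eq_zero_iff)

lemma Gamma_rGamma_Re: "Re z > 0 \<Longrightarrow> Gamma z * rGamma z = 1"
  using not_nonpos_Ints_if_Re_pos[of z] by (simp add: rGamma_inverse_Gamma Gamma_eq_zero_iff)

lemma Gamma_nz_Re: "Re z > 0 \<Longrightarrow> Gamma z \<noteq> 0"
  using not_nonpos_Ints_if_Re_pos[of z] by (simp add: Gamma_eq_zero_iff)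

lemma rGamma_shift_eq:
  fixes z :: complex
  shows "Re z > 0 \<Longrightarrow> rGamma (z + of_nat n) = rGamma z / pochhammer z n"
  by (simp add: rGamma_inverse_Gamma Gamma_shift_eq divide_inverse)

text \<open>The scheme of both summation theorems below: a contiguous relation makes a normalised
  sum invariant under a unit shift of a parameter, and the limit for large shifts evaluates
  it.\<close>

lemma periodic_tendsto_eq:
  fixes f :: "nat \<Rightarrow> complex"
  assumes "\<And>n. f (Suc n) = f n" "f \<longlonglongrightarrow> l"
  shows "f 0 = l"
proof -
  have "f n = f 0" for n by (induction n) (auto simp: assms)
  hence "f = (\<lambda>_. f 0)" by auto
  with assms(2) show ?thesis by (metis LIMSEQ_const_iff)
qed

lemma norm_pochhammer_mono:
  fixes z :: complex
  assumes "Re z > 0"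
  shows "norm (pochhammer z k) \<le> norm (pochhammer (z + of_nat N) k)"
  unfolding pochhammer_prod prod_norm[symmetric]
proof (rule prod_mono, safe)
  fix i
  have "(Re z + real i)\<^sup>2 \<le> (Re z + real N + real i)\<^sup>2"
    using assms by (intro power_mono) auto
  thus "norm (z + of_nat i) \<le> norm (z + of_nat N + of_nat i)"
    by (simp add: cmod_def)
qed auto

text \<open>The factor \<open>Gamma (c + of_nat N)\<close> turns the \<open>k\<close>-th term into a
  constant over \<open>pochhammer (c + of_nat N) k\<close>, so in the limit only
  \<open>k = 0\<close> survives. The terms at \<open>N = 0\<close> are the majorant for Tannery's
  theorem.\<close>

lemma hyp2F1_limit:
  fixes a b c :: complex
  assumes "Re a > 0" "Re b > 0" "Re c > 0" "Re (c - a - b) > 0"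
  shows "(\<lambda>N. (\<Sum>k. gamma_quot a 1 k * gamma_quot b (c + of_nat N) k) * Gamma (c + of_nat N)) \<longlonglongrightarrow> Gamma a * Gamma b"
proof -
  define t where "t = (\<lambda>k N. gamma_quot a 1 k * Gamma (b + of_nat k) * inverse (pochhammer (c + of_nat N) k))"
  have t_eq: "gamma_quot a 1 k * gamma_quot b (c + of_nat N) k * Gamma (c + of_nat N) = t k N" for k N
    using assms rGamma_shift_eq[of "c + of_nat N" k] Gamma_rGamma_Re[of "c + of_nat N"]
    by (simp add: t_def gamma_quot_def divide_inverse mult_ac)
  have summ: "summable (\<lambda>k. gamma_quot a 1 k * gamma_quot b (c + of_nat N) k)" for N
    using assms by (intro summable_norm_cancel[OF summable_gamma_quot2]) auto
  have sum_eq: "(\<Sum>k. gamma_quot a 1 k * gamma_quot b (c + of_nat N) k) * Gamma (c + of_nat N) = (\<Sum>k. t k N)" for N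
    using suminf_mult2[OF summ, of N "Gamma (c + of_nat N)"] by (simp add: t_eq)
  have "(\<lambda>N. \<Sum>k. t k N) \<longlonglongrightarrow> (\<Sum>k. gamma_quot a 1 k * Gamma (b + of_nat k) * (if k = 0 then 1 else 0))"
  proof (rule tannerys_theorem[where M = "\<lambda>k. norm (t k 0)", THEN conjunct2, THEN conjunct2])
    show "(\<lambda>N. t k N) \<longlonglongrightarrow> gamma_quot a 1 k * Gamma (b + of_nat k) * (if k = 0 then 1 else 0)" for k
      unfolding t_def by (intro tendsto_mult tendsto_const inverse_pochhammer_tendsto)
    have nz: "pochhammer c k \<noteq> 0" for k
      using assms not_nonpos_Ints_if_Re_pos[of c] by (auto dest: pochhammer_eq_0_imp_nonpos_Int)
    have "norm (t k N) \<le> norm (t k 0)" for k N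
      unfolding t_def norm_mult norm_inverse
      using norm_pochhammer_mono[of c k N] assms nz
      by (intro mult_left_mono le_imp_inverse_le) auto
    thus "\<forall>\<^sub>F (k, n) in sequentially \<times>\<^sub>F sequentially. norm (t k n) \<le> norm (t k 0)"
      by (simp add: case_prod_unfold)
    show "summable (\<lambda>k. norm (t k 0))"
      using summable_mult2[OF summable_gamma_quot2[of a b 1 c], of "norm (Gamma c)"] assms
      by (simp add: t_eq[symmetric] norm_mult)
  qed auto
  also have "(\<Sum>k. gamma_quot a 1 k * Gamma (b + of_nat k) * (if k = 0 then 1 else 0)) =
      (\<Sum>k\<in>{0}. gamma_quot a 1 k * Gamma (b + of_nat k) * (if k = 0 then 1 else 0))"
    by (rule suminf_finite) auto
  also have "\<dots> = Gamma a * Gamma b"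
    by (simp add: gamma_quot_def)
  finally show ?thesis by (simp add: sum_eq)
qed

theorem gauss_hyp2F1:
  fixes a b c :: complex
  assumes "Re a > 0" "Re b > 0" "Re c > 0" "Re (c - a - b) > 0"
  shows "(\<lambda>k. gamma_quot a 1 k * gamma_quot b c k) sums
           (Gamma a * Gamma b * Gamma (c - a - b) * rGamma (c - a) * rGamma (c - b))"
proof -
  define F where "F = (\<lambda>c. \<Sum>k. gamma_quot a 1 k * gamma_quot b c k)"
  have summ: "summable (\<lambda>k. gamma_quot a 1 k * gamma_quot b c k)" if "Re c > 0" "Re (c - a - b) > 0" for c
    using assms that by (intro summable_norm_cancel[OF summable_gamma_quot2]) auto
  have rec: "(c - a) * (c - b) * F (c + 1) = (c - a - b) * F c" if c: "Re c > 0" "Re (c - a - b) > 0" for c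
  proof -
    \<comment> \<open>Telescoping certificate: its differences are the contiguous relation term by
      term, and it tends to 0 because the summand has order \<open>n\<close> to the power
      \<open>a + b - c - 1\<close>.\<close>
    define G where "G = (\<lambda>n. of_nat n * (gamma_quot a 1 n * gamma_quot b c n))"
    have "(\<lambda>n. real n * (norm (gamma_quot a 1 n) * norm (gamma_quot b c n))) \<in>
        O(\<lambda>n. real n * (real n powr (Re a - Re 1) * real n powr (Re b - Re c)))"
      using assms c by (intro landau_o.big_mult gamma_quot_bigo landau_o.big_refl) auto
    also have "(\<lambda>n. real n * (real n powr (Re a - Re 1) * real n powr (Re b - Re c))) =
        (\<lambda>n. real n powr (Re (a + b - c)))"
    proof
      fix n show "real n * (real n powr (Re a - Re 1) * real n powr (Re b - Re c)) = real n powr (Re (a + b - c))"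
        by (cases "n = 0") (auto simp: powr_mult_base powr_add[symmetric] algebra_simps)
    qed
    finally have "G \<longlonglongrightarrow> 0"
      using c by (intro tendsto_0_if_bigo_powr[where p = "Re (a + b - c)"]) (auto simp: G_def norm_mult)
    hence "(\<lambda>n. G (Suc n) - G n) sums (0 - G 0)"
      by (rule telescope_sums)
    moreover have "G (Suc n) - G n = (c - a) * (c - b) * (gamma_quot a 1 n * gamma_quot b (c + 1) n)
        - (c - a - b) * (gamma_quot a 1 n * gamma_quot b c n)" for n
    proof -
      have "of_nat (Suc n) * gamma_quot a 1 (Suc n) = (a + of_nat n) * gamma_quot a 1 n"
        using gamma_quot_Suc[of a 1 n] assms by (simp add: add_ac)
      moreover have "gamma_quot b c (Suc n) = (b + of_nat n) * gamma_quot b (c + 1) n"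
        using gamma_quot_shift[of b 1 c n] gamma_quot_plus1_left[of b "c + 1" n] assms by simp
      ultimately have "G (Suc n) = (a + of_nat n) * (b + of_nat n) * (gamma_quot a 1 n * gamma_quot b (c + 1) n)"
        unfolding G_def by (metis (no_types, lifting) mult.assoc mult.commute)
      thus ?thesis
        unfolding G_def gamma_quot_plus1_right[of b c n] by algebra
    qed
    ultimately have "(\<lambda>n. (c - a) * (c - b) * (gamma_quot a 1 n * gamma_quot b (c + 1) n)
        - (c - a - b) * (gamma_quot a 1 n * gamma_quot b c n)) sums 0"
      by (simp add: G_def)
    moreover have "(\<lambda>n. (c - a) * (c - b) * (gamma_quot a 1 n * gamma_quot b (c + 1) n)
        - (c - a - b) * (gamma_quot a 1 n * gamma_quot b c n)) sums ((c - a) * (c - b) * F (c + 1) - (c - a - b) * F c)"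
      unfolding F_def using c by (intro sums_diff sums_mult summable_sums summ) auto
    ultimately show ?thesis using sums_unique2 by fastforce
  qed
  \<comment> \<open>The Gamma factors absorb \<open>(c - a) * (c - b)\<close> and
    \<open>c - a - b\<close> from \<open>rec\<close>, so that \<open>H\<close> is constant.\<close>
  define H where "H = (\<lambda>N. F (c + of_nat N) * (Gamma (c - a + of_nat N) * Gamma (c - b + of_nat N) * rGamma (c - a - b + of_nat N)))"
  have pos: "Re (c - a) > 0" "Re (c - b) > 0" using assms by auto
  have "H (Suc N) = H N" for N
  proof -
    have "H (Suc N) = F (c + of_nat N + 1) * ((c - a + of_nat N) * Gamma (c - a + of_nat N))
        * ((c - b + of_nat N) * Gamma (c - b + of_nat N)) * rGamma (c - a - b + of_nat N + 1)"
      using Gamma_plus1_Re[of "c - a + of_nat N"] Gamma_plus1_Re[of "c - b + of_nat N"] pos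
      by (simp add: H_def add_ac)
    also have "\<dots> = (c + of_nat N - a) * (c + of_nat N - b) * F (c + of_nat N + 1)
       * (Gamma (c - a + of_nat N) * Gamma (c - b + of_nat N) * rGamma (c - a - b + of_nat N + 1))"
      by (simp add: mult_ac diff_add_eq)
    also have "(c + of_nat N - a) * (c + of_nat N - b) * F (c + of_nat N + 1) =
        (c + of_nat N - a - b) * F (c + of_nat N)"
      using assms by (intro rec) auto
    also have "(c + of_nat N - a - b) * F (c + of_nat N) * (Gamma (c - a + of_nat N) * Gamma (c - b + of_nat N) * rGamma (c - a - b + of_nat N + 1)) =
       F (c + of_nat N) * (Gamma (c - a + of_nat N) * Gamma (c - b + of_nat N) * ((c - a - b + of_nat N) * rGamma (c - a - b + of_nat N + 1)))"
      by (simp add: mult_ac diff_add_eq)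
    also have "\<dots> = H N" unfolding rGamma_plus1 by (simp add: H_def)
    finally show ?thesis .
  qed
  moreover have "H \<longlonglongrightarrow> Gamma a * Gamma b * 1"
  proof -
    \<comment> \<open>Inserting \<open>Gamma (c + of_nat N) * rGamma (c + of_nat N) = 1\<close>
      splits \<open>H N\<close> into the quantity of \<open>hyp2F1_limit\<close> and a balanced
      quotient.\<close>
    have "(\<lambda>N. (F (c + of_nat N) * Gamma (c + of_nat N)) * (gamma_quot (c - a) (c - a - b) N * gamma_quot (c - b) c N))
        \<longlonglongrightarrow> Gamma a * Gamma b * 1"
      unfolding F_def using assms by (intro tendsto_mult hyp2F1_limit gamma_quot_balanced_tendsto_1) auto
    also have "(\<lambda>N. (F (c + of_nat N) * Gamma (c + of_nat N)) * (gamma_quot (c - a) (c - a - b) N * gamma_quot (c - b) c N)) = H"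
      using Gamma_rGamma_Re[of "c + of_nat N" for N] assms
      by (simp add: H_def gamma_quot_def fun_eq_iff mult_ac)
    finally show ?thesis .
  qed
  ultimately have "H 0 = Gamma a * Gamma b * 1" by (rule periodic_tendsto_eq)
  hence "F c * (Gamma (c - a) * Gamma (c - b) * rGamma (c - a - b)) = Gamma a * Gamma b"
    by (simp add: H_def)
  hence "F c = Gamma a * Gamma b * Gamma (c - a - b) * rGamma (c - a) * rGamma (c - b)"
    using Gamma_nz_Re[of "c - a"] Gamma_nz_Re[of "c - b"] Gamma_nz_Re[of "c - a - b"] assms
    by (simp add: rGamma_inverse_Gamma field_simps)
  thus ?thesis
    using summable_sums[OF summ, of c] assms by (simp add: F_def)
qed

section \<open>The nonterminating Saalschuetz theorem\<close>

text \<open>Up to the factor Gamma a Gamma b Gamma c / (Gamma e Gamma f) this is 3F2(a, b, c; e, f;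
  1); the lower parameter 1 of the first quotient produces the factorial.\<close>

definition gamma_sum3 :: "complex \<Rightarrow> complex \<Rightarrow> complex \<Rightarrow> complex \<Rightarrow> complex \<Rightarrow> complex" where
  "gamma_sum3 a b c e f = (\<Sum>n. gamma_quot a 1 n * gamma_quot b e n * gamma_quot c f n)"

lemma summable_gamma_sum3:
  assumes "Re a > 0" "Re b > 0" "Re c > 0" "Re e > 0" "Re f > 0" "Re (e + f - a - b - c) > 0"
  shows "summable (\<lambda>n. gamma_quot a 1 n * gamma_quot b e n * gamma_quot c f n)"
  using assms by (intro summable_norm_cancel[OF summable_gamma_quot3]) auto

lemma gamma_quot_balanced3_tendsto_1:
  fixes p q r s t u :: complex
  assumes "Re p > 0" "Re q > 0" "Re r > 0" "Re s > 0" "Re t > 0" "Re u > 0" "p + q + r = s + t + u"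
    and "Re (p + q - s) > 0"
  shows "(\<lambda>n. gamma_quot p s n * gamma_quot q t n * gamma_quot r u n) \<longlonglongrightarrow> 1"
proof -
  \<comment> \<open>\<open>v\<close> solves \<open>p + q = s + v\<close>, and then also
    \<open>v + r = t + u\<close>: the product splits into two balanced pairs in which the auxiliary
    Gamma factors cancel.\<close>
  define v where "v = p + q - s"
  have "(\<lambda>n. (gamma_quot p s n * gamma_quot q v n) * (gamma_quot v t n * gamma_quot r u n)) \<longlonglongrightarrow> 1 * 1"
    using assms by (intro tendsto_mult gamma_quot_balanced_tendsto_1) (auto simp: v_def algebra_simps)
  moreover have "gamma_quot q v n * gamma_quot v t n = gamma_quot q t n" for n
    using Gamma_rGamma_Re[of "v + of_nat n"] assms by (simp add: gamma_quot_def v_def mult_ac)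
  hence "(\<lambda>n. (gamma_quot p s n * gamma_quot q v n) * (gamma_quot v t n * gamma_quot r u n)) = (\<lambda>n. gamma_quot p s n * gamma_quot q t n * gamma_quot r u n)"
    by (simp add: fun_eq_iff mult.assoc[symmetric])
  ultimately show ?thesis by simp
qed

text \<open>Both sums have excess 1. In contrast to Gauss's theorem the telescoping boundary term
  tends to 1 and not to 0. The companion sum satisfies the same recurrence with the same right-hand
  side, so the difference of the two satisfies a homogeneous one.\<close>

lemma saalschuetz_rec:
  assumes pos: "Re a > 0" "Re b > 0" "Re s > 0" "Re e > 0" "Re (1 + a + b - e + s) > 0"
  shows "(1 + b - e + s) * (1 + a - e + s) * gamma_sum3 a b (s + 1) e (1 + a + b - e + (s + 1))
       - s * (s + 1 - e) * gamma_sum3 a b s e (1 + a + b - e + s) = 1"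
proof -
  define w where "w = 1 + a + b - e + s"
  have w: "Re w > 0" "1 + a + b - e + (s + 1) = w + 1" "1 + a + b - e + s = w"
    using pos by (auto simp: w_def add_ac)
  \<comment> \<open>Telescoping certificate. It vanishes at 0, and \<open>G (Suc n)\<close> is a
    balanced product of three quotients because \<open>e + w = 1 + a + b + s\<close>.\<close>
  define G where "G = (\<lambda>n. of_nat n * (e - 1 + of_nat n) * (gamma_quot a 1 n * gamma_quot b e n * gamma_quot s w n))"
  have G_Suc: "G (Suc n) = (a + of_nat n) * (b + of_nat n) * (s + of_nat n) * (gamma_quot a 1 n * gamma_quot b e n * gamma_quot s (w + 1) n)" for n
  proof -
    have "of_nat (Suc n) * gamma_quot a 1 (Suc n) = (a + of_nat n) * gamma_quot a 1 n"
      using gamma_quot_Suc[of a 1 n] pos by (simp add: add_ac)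
    moreover have "(e - 1 + of_nat (Suc n)) * gamma_quot b e (Suc n) = (b + of_nat n) * gamma_quot b e n"
      using gamma_quot_Suc[of b e n] pos by simp
    moreover have "gamma_quot s w (Suc n) = (s + of_nat n) * gamma_quot s (w + 1) n"
      using gamma_quot_shift[of s 1 w n] gamma_quot_plus1_left[of s "w + 1" n] pos by simp
    moreover have "G (Suc n) = (of_nat (Suc n) * gamma_quot a 1 (Suc n)) * ((e - 1 + of_nat (Suc n)) * gamma_quot b e (Suc n)) * gamma_quot s w (Suc n)"
      unfolding G_def by (simp only: mult_ac)
    ultimately show ?thesis by (simp only: mult_ac)
  qed
  have "(\<lambda>n. gamma_quot (a + 1) 1 n * gamma_quot (b + 1) e n * gamma_quot (s + 1) (w + 1) n) \<longlonglongrightarrow> 1"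
    using pos w(1) by (intro gamma_quot_balanced3_tendsto_1) (auto simp: w_def)
  also have "(\<lambda>n. gamma_quot (a + 1) 1 n * gamma_quot (b + 1) e n * gamma_quot (s + 1) (w + 1) n) = (\<lambda>n. G (Suc n))"
    using pos by (simp add: gamma_quot_plus1_left G_Suc mult_ac)
  finally have "G \<longlonglongrightarrow> 1" by (simp add: filterlim_sequentially_Suc)
  hence "(\<lambda>n. G (Suc n) - G n) sums (1 - G 0)"
    by (rule telescope_sums)
  moreover have "G (Suc n) - G n = (1 + b - e + s) * (1 + a - e + s) * (gamma_quot a 1 n * gamma_quot b e n * gamma_quot (s + 1) (w + 1) n)
      - s * (s + 1 - e) * (gamma_quot a 1 n * gamma_quot b e n * gamma_quot s w n)" for n
  proof -
    show ?thesis
      unfolding G_Suc gamma_quot_plus1_left[OF pos(3), of "w + 1" n] unfolding G_def gamma_quot_plus1_right[of s w n]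
      using w_def by algebra
  qed
  ultimately have *: "(\<lambda>n. (1 + b - e + s) * (1 + a - e + s) * (gamma_quot a 1 n * gamma_quot b e n * gamma_quot (s + 1) (w + 1) n)
      - s * (s + 1 - e) * (gamma_quot a 1 n * gamma_quot b e n * gamma_quot s w n)) sums 1"
    by (simp add: G_def)
  have **: "(\<lambda>n. (1 + b - e + s) * (1 + a - e + s) * (gamma_quot a 1 n * gamma_quot b e n * gamma_quot (s + 1) (w + 1) n)
      - s * (s + 1 - e) * (gamma_quot a 1 n * gamma_quot b e n * gamma_quot s w n)) sums
     ((1 + b - e + s) * (1 + a - e + s) * gamma_sum3 a b (s + 1) e (w + 1) - s * (s + 1 - e) * gamma_sum3 a b s e w)"
    unfolding gamma_sum3_def using pos w(1)
    by (intro sums_diff sums_mult summable_sums summable_gamma_sum3) (auto simp: w_def)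
  show ?thesis
    unfolding w using sums_unique2[OF ** *] .
qed

lemma norm_pochhammer_quot_le_1:
  fixes s d :: complex
  assumes "Re d > 0" "Re s > 0"
  shows "eventually (\<lambda>N. \<forall>k. norm (pochhammer (s + of_nat N) k / pochhammer (d + s + of_nat N) k) \<le> 1) sequentially"
proof -
  \<comment> \<open>With \<open>x = s + of_nat N\<close>, the difference of squares |d + x|^2 -
    |x|^2 is \<open>Re d * (2 * Re x + Re d) + Im d * (2 * Im x + Im d)\<close>. From
    \<open>M\<close> on, the first summand outweighs the second whatever its sign.\<close>
  define M where "M = nat \<lceil>\<bar>Im d * (2 * Im s + Im d)\<bar> / Re d\<rceil>"
  have le: "norm (s + of_nat N) \<le> norm (d + s + of_nat N)" if "N \<ge> M" for N
  proof -
    have "\<bar>Im d * (2 * Im s + Im d)\<bar> / Re d \<le> real N"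
      using that unfolding M_def by linarith
    hence "- (Im d * (2 * Im s + Im d)) \<le> Re d * real N"
      using assms by (simp add: field_simps abs_le_iff)
    also have "\<dots> \<le> Re d * (2 * (Re s + real N) + Re d)"
      using assms by (intro mult_left_mono) auto
    finally have "(Re s + real N)\<^sup>2 + (Im s)\<^sup>2 \<le> (Re d + Re s + real N)\<^sup>2 + (Im d + Im s)\<^sup>2"
      by (simp add: power2_eq_square algebra_simps)
    thus ?thesis by (simp add: cmod_def)
  qed
  have "norm (pochhammer (s + of_nat N) k / pochhammer (d + s + of_nat N) k) \<le> 1" if "N \<ge> M" for N k
  proof -
    have "norm (pochhammer (s + of_nat N) k) \<le> norm (pochhammer (d + s + of_nat N) k)"
      unfolding pochhammer_prod prod_norm[symmetric]
      using le[of "N + i" for i] that by (intro prod_mono) (auto simp: add_ac)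
    thus ?thesis by (simp add: norm_divide divide_le_eq_1)
  qed
  thus ?thesis by (auto simp: eventually_sequentially)
qed

text \<open>When one numerator and one denominator parameter go to infinity at a fixed distance, the
  quotient of their Pochhammer symbols tends to 1 and the 3F2 degenerates to the Gauss sum with
  parameters \<open>a\<close>, \<open>b\<close>, \<open>e\<close>.\<close>

lemma gamma_sum3_limit:
  assumes "Re a > 0" "Re b > 0" "Re s > 0" "Re e > 0" "Re (1 + a + b - e) > 0" "Re (e - a - b) > 0"
  shows "(\<lambda>N. gamma_sum3 a b (s + of_nat N) e (1 + a + b - e + (s + of_nat N))
            * gamma_quot (1 + a + b - e + s) s N) \<longlonglongrightarrow>
     Gamma a * Gamma b * Gamma (e - a - b) * rGamma (e - a) * rGamma (e - b)"
proof -
  define d where "d = 1 + a + b - e"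
  have d: "Re d > 0" using assms by (simp add: d_def)
  define t where "t = (\<lambda>n N. gamma_quot a 1 n * gamma_quot b e n * (pochhammer (s + of_nat N) n / pochhammer (d + s + of_nat N) n))"
  have t_eq: "gamma_quot a 1 n * gamma_quot b e n * gamma_quot (s + of_nat N) (d + (s + of_nat N)) n * gamma_quot (d + s) s N = t n N" for n N
  proof -
    have "gamma_quot (s + of_nat N) (d + (s + of_nat N)) n = (pochhammer (s + of_nat N) n * Gamma (s + of_nat N)) *
        (rGamma (d + s + of_nat N) / pochhammer (d + s + of_nat N) n)"
      using assms d Gamma_shift_eq[of "s + of_nat N" n] rGamma_shift_eq[of "d + s + of_nat N" n]
      by (simp add: gamma_quot_def add_ac)
    also have "\<dots> * gamma_quot (d + s) s N = pochhammer (s + of_nat N) n / pochhammer (d + s + of_nat N) n *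
        (Gamma (s + of_nat N) * rGamma (s + of_nat N)) * (Gamma (d + s + of_nat N) * rGamma (d + s + of_nat N))"
      by (simp add: gamma_quot_def)
    also have "\<dots> = pochhammer (s + of_nat N) n / pochhammer (d + s + of_nat N) n"
      using Gamma_rGamma_Re[of "s + of_nat N"] Gamma_rGamma_Re[of "d + s + of_nat N"] assms d by simp
    finally show ?thesis by (simp add: t_def mult.assoc)
  qed
  have summ: "summable (\<lambda>n. gamma_quot a 1 n * gamma_quot b e n * gamma_quot (s + of_nat N) (d + (s + of_nat N)) n)" for N
    using assms d by (intro summable_gamma_sum3) (auto simp: d_def)
  have sum_eq: "gamma_sum3 a b (s + of_nat N) e (d + (s + of_nat N)) * gamma_quot (d + s) s N = (\<Sum>n. t n N)" for N
    using suminf_mult2[OF summ, of N "gamma_quot (d + s) s N"] by (simp add: t_eq gamma_sum3_def)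
  have "(\<lambda>N. \<Sum>n. t n N) \<longlonglongrightarrow> (\<Sum>n. gamma_quot a 1 n * gamma_quot b e n * 1)"
  proof (rule tannerys_theorem[where M = "\<lambda>n. norm (gamma_quot a 1 n * gamma_quot b e n)", THEN conjunct2, THEN conjunct2])
    show "(\<lambda>N. t n N) \<longlonglongrightarrow> gamma_quot a 1 n * gamma_quot b e n * 1" for n
      unfolding t_def by (intro tendsto_mult tendsto_const pochhammer_quot_tendsto)
    have ev: "eventually (\<lambda>x. True \<and> (\<forall>k. norm (pochhammer (s + of_nat (snd x)) k / pochhammer (d + s + of_nat (snd x)) k) \<le> 1))
       (sequentially \<times>\<^sub>F sequentially)"
      using eventually_prodI[OF eventually_True norm_pochhammer_quot_le_1[of d s]] d assms by simp
    show "\<forall>\<^sub>F (n, N) in sequentially \<times>\<^sub>F sequentially. norm (t n N) \<le> norm (gamma_quot a 1 n * gamma_quot b e n)"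
      using ev
    proof eventually_elim
      case (elim x)
      show ?case
        using mult_left_mono[OF elim[THEN conjunct2, THEN spec, of "fst x"], of "norm (gamma_quot a 1 (fst x) * gamma_quot b e (fst x))"]
        by (simp add: t_def case_prod_unfold norm_mult norm_divide)
    qed
    show "summable (\<lambda>n. norm (gamma_quot a 1 n * gamma_quot b e n))"
      using assms by (intro summable_gamma_quot2) auto
  qed auto
  also have "(\<Sum>n. gamma_quot a 1 n * gamma_quot b e n * 1) = Gamma a * Gamma b * Gamma (e - a - b) * rGamma (e - a) * rGamma (e - b)"
    using sums_unique[OF gauss_hyp2F1[of a b e]] assms by simp
  finally show ?thesis unfolding d_def[symmetric] sum_eq .
qed

lemma sin_prod_diff:
  fixes x y z :: complex
  shows "sin (x - y) * sin (x - z) - sin y * sin z = sin x * sin (x - y - z)"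
proof -
  have "sin x ^ 2 = 1 - cos x ^ 2" "sin y ^ 2 = 1 - cos y ^ 2" "sin z ^ 2 = 1 - cos z ^ 2"
    by (simp_all add: sin_squared_eq)
  thus ?thesis unfolding sin_diff cos_diff by algebra
qed

text \<open>The left side is the limit found for the normalised difference of the two Saalschuetz
  sums. Reflection of all \<open>rGamma\<close> factors leaves one common product of Gamma values,
  and the sines are handled by \<open>sin_prod_diff\<close>.\<close>

lemma saalschuetz_constant:
  fixes a b e :: complex
  assumes "Re a > 0" "Re b > 0" "Re (1 + a - e) > 0" "Re (1 + b - e) > 0"
    and "Re (e - a - b) > 0"
  shows "Gamma a * Gamma b * Gamma (e - a - b) * rGamma (e - a) * rGamma (e - b)
     - Gamma (1 + a - e) * Gamma (1 + b - e) * Gamma (e - a - b) * rGamma (1 - a) * rGamma (1 - b)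
     = sin (of_real pi * e) / of_real pi * Gamma a * Gamma b * Gamma (1 + a - e) * Gamma (1 + b - e) * rGamma (1 + a + b - e)"
proof -
  have R: "rGamma (1 - z) = Gamma z * (sin (of_real pi * z) / of_real pi)" if "Re z > 0" for z
    using rGamma_reflection_complex[of z] Gamma_rGamma_Re[OF that]
    by (metis mult.assoc mult_1)
  have R': "rGamma z = Gamma (1 - z) * (sin (of_real pi * z) / of_real pi)" if "Re (1 - z) > 0" for z
    using rGamma_reflection_complex[of z] Gamma_rGamma_Re[OF that]
    by (metis mult.assoc mult.commute mult_1)
  have 1: "rGamma (e - a) = Gamma (1 + a - e) * (sin (of_real pi * (e - a)) / of_real pi)"
    using R'[of "e - a"] assms by (simp add: algebra_simps)
  have 2: "rGamma (e - b) = Gamma (1 + b - e) * (sin (of_real pi * (e - b)) / of_real pi)"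
    using R'[of "e - b"] assms by (simp add: algebra_simps)
  have 3: "rGamma (1 + a + b - e) = Gamma (e - a - b) * (sin (of_real pi * (e - a - b)) / of_real pi)"
    using R[of "e - a - b"] assms by (simp add: algebra_simps)
  have "sin (of_real pi * (e - a)) * sin (of_real pi * (e - b)) - sin (of_real pi * a) * sin (of_real pi * b)
     = sin (of_real pi * e) * sin (complex_of_real pi * (e - a - b))"
    using sin_prod_diff[of "of_real pi * e" "of_real pi * a" "of_real pi * b"] by (simp add: right_diff_distrib)
  thus ?thesis
    unfolding 1 2 3 R[OF assms(1)] R[OF assms(2)] by (simp add: divide_inverse) algebra
qed

text \<open>The passage to \<open>1 + a - e\<close>, \<open>1 + b - e\<close>,
  \<open>1 + s - e\<close>, \<open>2 - e\<close> is an involution that preserves \<open>d\<close>,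
  and a unit shift of \<open>s\<close> shifts \<open>1 + s - e\<close> along with it. Hence
  \<open>saalschuetz_rec\<close> applies to both sums simultaneously, and its constant 1 cancels in
  the difference \<open>D\<close>.\<close>

theorem nonterminating_saalschuetz:
  assumes pos: "Re a > 0" "Re b > 0" "Re s > 0" "Re e > 0" "Re (2 - e) > 0"
    "Re (1 + a - e) > 0" "Re (1 + b - e) > 0" "Re (1 + s - e) > 0"
    "Re (1 + a + b - e) > 0" "Re (e - a - b) > 0"
  shows "gamma_sum3 a b s e (1 + a + b - e + s)
      - gamma_sum3 (1 + a - e) (1 + b - e) (1 + s - e) (2 - e) (1 + a + b - e + (1 + s - e)) =
    sin (of_real pi * e) / of_real pi * Gamma a * Gamma b * Gamma (1 + a - e) * Gamma (1 + b - e) * rGamma (1 + a + b - e)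
      * (Gamma s * Gamma (1 + s - e) * rGamma (1 + b - e + s) * rGamma (1 + a - e + s))"
proof -
  define d where "d = 1 + a + b - e"
  define a' b' e' where "a' = 1 + a - e" "b' = 1 + b - e" "e' = 2 - e"
  define s' where "s' = (\<lambda>s. 1 + s - e)"
  have d': "1 + a' + b' - e' = d" by (simp add: a'_b'_e'_def d_def)
  define D where "D = (\<lambda>s. gamma_sum3 a b s e (d + s) - gamma_sum3 a' b' (s' s) e' (d + s' s))"
  have rec: "(1 + b - e + s) * (1 + a - e + s) * D (s + 1) = s * (1 + s - e) * D s"
    if s: "Re s > 0" "Re (1 + s - e) > 0" for s
  proof -
    have 1: "(1 + b - e + s) * (1 + a - e + s) * gamma_sum3 a b (s + 1) e (d + (s + 1)) - s * (s + 1 - e) * gamma_sum3 a b s e (d + s) = 1"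
      unfolding d_def using pos s by (intro saalschuetz_rec) auto
    have 2: "(1 + b' - e' + s' s) * (1 + a' - e' + s' s) * gamma_sum3 a' b' (s' s + 1) e' (d + (s' s + 1)) - s' s * (s' s + 1 - e') * gamma_sum3 a' b' (s' s) e' (d + s' s) = 1"
      using pos s saalschuetz_rec[of a' b' "s' s" e'] unfolding d' by (auto simp: a'_b'_e'_def s'_def d_def)
    have 3: "1 + b' - e' + s' s = 1 + b - e + s" "1 + a' - e' + s' s = 1 + a - e + s" "s' s + 1 - e' = s"
      "s' s = s + 1 - e" "s' s + 1 = s' (s + 1)"
      by (simp_all add: a'_b'_e'_def s'_def)
    have 2: "(1 + b - e + s) * (1 + a - e + s) * gamma_sum3 a' b' (s' (s + 1)) e' (d + s' (s + 1)) - s' s * s * gamma_sum3 a' b' (s' s) e' (d + s' s) = 1"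
      using 2 unfolding 3(1-3) unfolding 3(5) .
    have "D (s + 1) = gamma_sum3 a b (s + 1) e (d + (s + 1)) - gamma_sum3 a' b' (s' (s + 1)) e' (d + s' (s + 1))"
      "D s = gamma_sum3 a b s e (d + s) - gamma_sum3 a' b' (s' s) e' (d + s' s)"
      by (simp_all add: D_def)
    thus ?thesis using 1 2 3(4) by algebra
  qed
  \<comment> \<open>\<open>P\<close> absorbs the factors of \<open>rec\<close>. It is split in two
    ways, one for each sum: every time into the normaliser required by
    \<open>gamma_sum3_limit\<close> and a balanced quotient that tends to 1.\<close>
  define P where "P = (\<lambda>N. Gamma (1 + b - e + s + of_nat N) * Gamma (1 + a - e + s + of_nat N) * rGamma (s + of_nat N) * rGamma (1 + s - e + of_nat N))"
  define H where "H = (\<lambda>N. D (s + of_nat N) * P N)"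
  have "H (Suc N) = H N" for N
  proof -
    let ?n = "of_nat N :: complex"
    have "P (Suc N) = ((1 + b - e + (s + ?n)) * Gamma (1 + b - e + s + ?n)) * ((1 + a - e + (s + ?n)) * Gamma (1 + a - e + s + ?n))
        * rGamma (s + ?n + 1) * rGamma (1 + s - e + ?n + 1)"
      using Gamma_plus1_Re[of "1 + b - e + s + ?n"] Gamma_plus1_Re[of "1 + a - e + s + ?n"] pos
      by (simp add: P_def add_ac)
    hence "H (Suc N) = ((1 + b - e + (s + ?n)) * (1 + a - e + (s + ?n)) * D (s + ?n + 1)) *
        (Gamma (1 + b - e + s + ?n) * Gamma (1 + a - e + s + ?n) * rGamma (s + ?n + 1) * rGamma (1 + s - e + ?n + 1))"
      by (simp add: H_def add_ac mult_ac)
    also have "(1 + b - e + (s + ?n)) * (1 + a - e + (s + ?n)) * D (s + ?n + 1) = (s + ?n) * (1 + (s + ?n) - e) * D (s + ?n)"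
      using pos by (intro rec) auto
    also have "(s + ?n) * (1 + (s + ?n) - e) * D (s + ?n) *
        (Gamma (1 + b - e + s + ?n) * Gamma (1 + a - e + s + ?n) * rGamma (s + ?n + 1) * rGamma (1 + s - e + ?n + 1))
      = D (s + ?n) * (Gamma (1 + b - e + s + ?n) * Gamma (1 + a - e + s + ?n) *
          ((s + ?n) * rGamma (s + ?n + 1)) * ((1 + s - e + ?n) * rGamma (1 + s - e + ?n + 1)))"
      by (simp add: mult_ac add_ac diff_add_eq add_diff_eq)
    also have "\<dots> = H N"
      unfolding rGamma_plus1 by (simp add: H_def P_def)
    finally show ?thesis .
  qed
  moreover have "H \<longlonglongrightarrow> Gamma a * Gamma b * Gamma (e - a - b) * rGamma (e - a) * rGamma (e - b)
     - Gamma (1 + a - e) * Gamma (1 + b - e) * Gamma (e - a - b) * rGamma (1 - a) * rGamma (1 - b)"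
  proof -
    have 1: "(\<lambda>N. gamma_sum3 a b (s + of_nat N) e (d + (s + of_nat N)) * P N) \<longlonglongrightarrow>
        Gamma a * Gamma b * Gamma (e - a - b) * rGamma (e - a) * rGamma (e - b)"
    proof -
      have "(\<lambda>N. (gamma_sum3 a b (s + of_nat N) e (d + (s + of_nat N)) * gamma_quot (d + s) s N) *
          (gamma_quot (1 + b - e + s) (1 + s - e) N * gamma_quot (1 + a - e + s) (d + s) N)) \<longlonglongrightarrow>
          (Gamma a * Gamma b * Gamma (e - a - b) * rGamma (e - a) * rGamma (e - b)) * 1"
        unfolding d_def using pos by (intro tendsto_mult gamma_sum3_limit gamma_quot_balanced_tendsto_1) auto
      moreover have "gamma_quot (d + s) s N * (gamma_quot (1 + b - e + s) (1 + s - e) N * gamma_quot (1 + a - e + s) (d + s) N) = P N" for N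
        using Gamma_rGamma_Re[of "d + s + of_nat N"] pos by (simp add: gamma_quot_def P_def d_def)
      ultimately show ?thesis by (simp add: mult.assoc)
    qed
    have 2: "(\<lambda>N. gamma_sum3 a' b' (s' (s + of_nat N)) e' (d + s' (s + of_nat N)) * P N) \<longlonglongrightarrow>
        Gamma a' * Gamma b' * Gamma (e' - a' - b') * rGamma (e' - a') * rGamma (e' - b')"
    proof -
      have lim: "(\<lambda>N. gamma_sum3 a' b' (s' s + of_nat N) e' (d + (s' s + of_nat N)) * gamma_quot (d + s' s) (s' s) N)
        \<longlonglongrightarrow> Gamma a' * Gamma b' * Gamma (e' - a' - b') * rGamma (e' - a') * rGamma (e' - b')"
        using gamma_sum3_limit[of a' b' "s' s" e'] pos unfolding d' by (auto simp: a'_b'_e'_def s'_def d_def)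
      have "(\<lambda>N. (gamma_sum3 a' b' (s' s + of_nat N) e' (d + (s' s + of_nat N)) * gamma_quot (d + s' s) (s' s) N) *
          (gamma_quot (1 + b - e + s) s N * gamma_quot (1 + a - e + s) (d + s' s) N)) \<longlonglongrightarrow>
          (Gamma a' * Gamma b' * Gamma (e' - a' - b') * rGamma (e' - a') * rGamma (e' - b')) * 1"
        using pos by (intro tendsto_mult lim gamma_quot_balanced_tendsto_1) (auto simp: d_def s'_def)
      moreover have "gamma_quot (d + s' s) (s' s) N * (gamma_quot (1 + b - e + s) s N * gamma_quot (1 + a - e + s) (d + s' s) N) = P N" for N
        using Gamma_rGamma_Re[of "d + s' s + of_nat N"] pos by (simp add: gamma_quot_def P_def d_def s'_def)
      moreover have "s' (s + of_nat N) = s' s + of_nat N" for N by (simp add: s'_def)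
      ultimately show ?thesis by (simp add: mult.assoc)
    qed
    have "e - b - a = e - a - b" by simp
    with tendsto_diff[OF 1 2] show ?thesis
      by (simp add: H_def D_def a'_b'_e'_def left_diff_distrib)
  qed
  ultimately have "H 0 = Gamma a * Gamma b * Gamma (e - a - b) * rGamma (e - a) * rGamma (e - b)
     - Gamma (1 + a - e) * Gamma (1 + b - e) * Gamma (e - a - b) * rGamma (1 - a) * rGamma (1 - b)"
    by (rule periodic_tendsto_eq)
  also have "\<dots> = sin (of_real pi * e) / of_real pi * Gamma a * Gamma b * Gamma (1 + a - e) * Gamma (1 + b - e) * rGamma (1 + a + b - e)" (is "_ = ?K")
    using pos by (intro saalschuetz_constant) auto
  finally have "D s * P 0 = ?K" by (simp add: H_def)
  moreover have "P 0 * (Gamma s * Gamma (1 + s - e) * rGamma (1 + b - e + s) * rGamma (1 + a - e + s)) =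
     (Gamma s * rGamma s) * (Gamma (1 + s - e) * rGamma (1 + s - e)) * (Gamma (1 + b - e + s) * rGamma (1 + b - e + s))
       * (Gamma (1 + a - e + s) * rGamma (1 + a - e + s))"
    by (simp add: P_def)
  moreover have "\<dots> = 1"
    using pos by (simp add: Gamma_rGamma_Re)
  ultimately have "D s = ?K * (Gamma s * Gamma (1 + s - e) * rGamma (1 + b - e + s) * rGamma (1 + a - e + s))"
    by (metis mult.assoc mult.right_neutral)
  thus ?thesis by (simp add: D_def d_def a'_b'_e'_def s'_def)
qed

section \<open>The double series and its symmetry\<close>

text \<open>Termwise, \<open>w - c\<close> is \<open>(w + n) - (c + n)\<close>, and each part is
  absorbed by a Gamma factor. A sum is thereby expressed through two sums whose excess is smaller by
  one.\<close>

lemma gamma_sum3_contiguous: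
  assumes "Re a > 0" "Re b > 0" "Re c > 0" "Re e > 0" "Re w > 0" "Re (e + w - a - b - c) > 0"
  shows "(w - c) * gamma_sum3 a b c e (w + 1) = gamma_sum3 a b c e w - gamma_sum3 a b (c + 1) e (w + 1)"
proof -
  have 1: "summable (\<lambda>n. gamma_quot a 1 n * gamma_quot b e n * gamma_quot c w n)"
    and 2: "summable (\<lambda>n. gamma_quot a 1 n * gamma_quot b e n * gamma_quot (c + 1) (w + 1) n)"
    and 3: "summable (\<lambda>n. gamma_quot a 1 n * gamma_quot b e n * gamma_quot c (w + 1) n)"
    using assms by (auto intro!: summable_gamma_sum3)
  have "(w - c) * gamma_quot c (w + 1) n = gamma_quot c w n - gamma_quot (c + 1) (w + 1) n" for n
    unfolding gamma_quot_plus1_right[of c w n] gamma_quot_plus1_left[OF assms(3)] by (simp add: algebra_simps)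
  hence eq: "(w - c) * (gamma_quot a 1 n * gamma_quot b e n * gamma_quot c (w + 1) n) =
      gamma_quot a 1 n * gamma_quot b e n * gamma_quot c w n - gamma_quot a 1 n * gamma_quot b e n * gamma_quot (c + 1) (w + 1) n" for n
    by (metis (no_types, lifting) mult.left_commute right_diff_distrib)
  have "(w - c) * gamma_sum3 a b c e (w + 1) = (\<Sum>n. (w - c) * (gamma_quot a 1 n * gamma_quot b e n * gamma_quot c (w + 1) n))"
    unfolding gamma_sum3_def by (rule suminf_mult[OF 3, symmetric])
  thus ?thesis
    unfolding eq gamma_sum3_def using suminf_diff[OF 1 2] by simp
qed

text \<open>For \<open>m = 0\<close> this is the nonterminating Saalschuetz theorem combined with Gauss's theorem; both sides
  satisfy \<open>Z\<^sub>m\<^sub>+\<^sub>1(s) = Z\<^sub>m(s) - Z\<^sub>m(s + 1)\<close>.\<close>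

lemma gamma_sum3_difference_lift:
  fixes a b e d :: complex
  assumes pos: "Re a > 0" "Re b > 0" "Re e > 0" "Re (2 - e) > 0"
    "Re (1 + a - e) > 0" "Re (1 + b - e) > 0" "Re d > 0" "Re (1 - d) > 0"
    and d: "d = 1 + a + b - e"
    and s: "Re s > 0" "Re (1 + s - e) > 0"
  shows "Gamma (d + of_nat m) * (gamma_sum3 a b s e (d + of_nat m + s)
      - gamma_sum3 (1 + a - e) (1 + b - e) (1 + s - e) (2 - e) (d + of_nat m + (1 + s - e))) =
    sin (of_real pi * e) / of_real pi * Gamma (1 + a - e) * Gamma (1 + b - e)
      * (Gamma s * gamma_sum3 a b (d + of_nat m) d (d + of_nat m + s))"
  using s
proof (induction m arbitrary: s)
  case 0
  define K where "K = sin (of_real pi * e) / of_real pi * Gamma (1 + a - e) * Gamma (1 + b - e)"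
  \<comment> \<open>On the right-hand side \<open>d\<close> is now both a numerator and a
    denominator parameter and cancels, so Gauss's theorem evaluates the sum.\<close>
  have quot1: "gamma_quot d d n = 1" for n
    using Gamma_rGamma_Re[of "d + of_nat n"] pos by (simp add: gamma_quot_def)
  have "gamma_quot a 1 n * gamma_quot b d n * gamma_quot d (d + s) n = gamma_quot a 1 n * gamma_quot b (d + s) n" for n
    using quot1[of n] gamma_quot_mult_swap[of b d n d "d + s"] by (simp add: mult.assoc)
  hence "gamma_sum3 a b d d (d + s) = (\<Sum>n. gamma_quot a 1 n * gamma_quot b (d + s) n)"
    by (simp only: gamma_sum3_def)
  also have "\<dots> = Gamma a * Gamma b * Gamma (d + s - a - b) * rGamma (d + s - a) * rGamma (d + s - b)"
    using pos 0 d by (intro sums_unique[OF gauss_hyp2F1, symmetric]) (auto simp: d)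
  finally have X: "gamma_sum3 a b d d (d + s) = Gamma a * Gamma b * Gamma (1 + s - e) * rGamma (1 + b - e + s) * rGamma (1 + a - e + s)"
    by (simp add: d algebra_simps)
  have "gamma_sum3 a b s e (d + s) - gamma_sum3 (1 + a - e) (1 + b - e) (1 + s - e) (2 - e) (d + (1 + s - e)) =
      K * (rGamma d * (Gamma s * gamma_sum3 a b d d (d + s)))"
    unfolding X unfolding d K_def using pos d 0 by (subst nonterminating_saalschuetz) (auto simp: mult_ac)
  hence "Gamma d * (gamma_sum3 a b s e (d + s) - gamma_sum3 (1 + a - e) (1 + b - e) (1 + s - e) (2 - e) (d + (1 + s - e))) =
      (Gamma d * rGamma d) * (K * (Gamma s * gamma_sum3 a b d d (d + s)))"
    by simp
  thus ?case using Gamma_rGamma_Re[of d] pos by (simp add: K_def)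
next
  case (Suc m)
  define K where "K = sin (of_real pi * e) / of_real pi * Gamma (1 + a - e) * Gamma (1 + b - e)"
  define x where "x = d + of_nat m"
  define a' b' e' where "a' = 1 + a - e" "b' = 1 + b - e" "e' = 2 - e"
  have x: "Re x > 0" "x \<noteq> 0" using pos by (auto simp: x_def complex_eq_iff)
  have x_ge: "Re x \<ge> Re d" by (simp add: x_def)
  have IH: "Gamma x * (gamma_sum3 a b s e (x + s) - gamma_sum3 a' b' (1 + s - e) e' (x + (1 + s - e))) =
      K * (Gamma s * gamma_sum3 a b x d (x + s))" if "Re s > 0" "Re (1 + s - e) > 0" for s
    using Suc.IH[of s] that unfolding K_def x_def a'_b'_e'_def by simp
  \<comment> \<open>The contiguous factor is \<open>x\<close> in the first two relations and
    \<open>s\<close> in the third. These are the factors in \<open>Gamma (x + 1)\<close> and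
    \<open>Gamma (s + 1)\<close>, so the claim is the induction hypothesis at \<open>s\<close> minus
    that at \<open>s + 1\<close>.\<close>
  have 1: "x * gamma_sum3 a b s e (x + s + 1) = gamma_sum3 a b s e (x + s) - gamma_sum3 a b (s + 1) e (x + s + 1)"
    using gamma_sum3_contiguous[of a b s e "x + s"] pos Suc.prems x x_ge by (simp add: d)
  have 2: "x * gamma_sum3 a' b' (1 + s - e) e' (x + (1 + s - e) + 1) =
      gamma_sum3 a' b' (1 + s - e) e' (x + (1 + s - e)) - gamma_sum3 a' b' (1 + s - e + 1) e' (x + (1 + s - e) + 1)"
    using gamma_sum3_contiguous[of a' b' "1 + s - e" e' "x + (1 + s - e)"] pos Suc.prems x x_ge
    by (simp add: d a'_b'_e'_def)
  have 3: "s * gamma_sum3 a b x d (x + s + 1) = gamma_sum3 a b x d (x + s) - gamma_sum3 a b (x + 1) d (x + s + 1)"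
    using gamma_sum3_contiguous[of a b x d "x + s"] pos Suc.prems x x_ge by (simp add: d)
  have G: "Gamma (x + 1) = x * Gamma x" "Gamma (s + 1) = s * Gamma s"
    using x Suc.prems by (simp_all add: Gamma_plus1_Re)
  have e1: "x + (s + 1) = x + s + 1" "1 + (s + 1) - e = 1 + s - e + 1" "x + (1 + s - e + 1) = x + (1 + s - e) + 1"
    by simp_all
  have I1: "Gamma x * (gamma_sum3 a b s e (x + s) - gamma_sum3 a' b' (1 + s - e) e' (x + (1 + s - e))) =
      K * (Gamma s * gamma_sum3 a b x d (x + s))"
    by (rule IH[OF Suc.prems])
  have I2: "Gamma x * (gamma_sum3 a b (s + 1) e (x + s + 1) - gamma_sum3 a' b' (1 + s - e + 1) e' (x + (1 + s - e) + 1)) =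
      K * (Gamma (s + 1) * gamma_sum3 a b x d (x + s + 1))"
    using IH[of "s + 1"] Suc.prems unfolding e1 by simp
  have "Gamma (x + 1) * (gamma_sum3 a b s e (x + s + 1) - gamma_sum3 a' b' (1 + s - e) e' (x + (1 + s - e) + 1)) =
      K * (Gamma s * gamma_sum3 a b (x + 1) d (x + s + 1))"
    using 1 2 3 I1 I2 unfolding G by algebra
  thus ?case
    by (simp add: K_def x_def a'_b'_e'_def add_ac add_diff_eq)
qed

section \<open>Majorants with real parameters\<close>

lemma norm_mult_le:
  fixes x y :: complex
  assumes "norm x \<le> A * X" "norm y \<le> B * Y"
  shows "norm (x * y) \<le> (A * B) * (X * Y)"
proof -
  have "norm x * norm y \<le> (A * X) * (B * Y)"
    using assms by (intro mult_mono) (auto intro: order_trans[OF norm_ge_zero])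
  thus ?thesis by (simp add: norm_mult mult_ac)
qed

lemma norm_gamma_quot_le:
  fixes z w :: complex
  assumes "Re z > 0" "Re w > 0"
  obtains C where "C > 0" "\<And>n. norm (gamma_quot z w n) \<le> C * gamma_quot (Re z) (Re w) n"
proof -
  obtain A where A: "A > 0" "\<And>n. norm (Gamma (z + of_nat n)) \<le> A * Gamma (Re z + real n)"
    using norm_Gamma_shift_le[OF assms(1)] by blast
  obtain B where B: "B > 0" "\<And>n. norm (rGamma (w + of_nat n)) \<le> B * rGamma (Re w + real n)"
    using norm_rGamma_shift_le[OF assms(2)] by blast
  show ?thesis
    using norm_mult_le[OF A(2) B(2)] A(1) B(1) by (intro that[of "A * B"]) (auto simp: gamma_quot_def)
qed

lemma gauss_hyp2F1_real:
  fixes a b c :: real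
  assumes "a > 0" "b > 0" "c > 0" "c - a - b > 0"
  shows "(\<lambda>k. gamma_quot a 1 k * gamma_quot b c k) sums
           (Gamma a * Gamma b * Gamma (c - a - b) * rGamma (c - a) * rGamma (c - b))"
proof -
  have "(\<lambda>k. gamma_quot (of_real a) 1 k * gamma_quot (of_real b) (of_real c) k) sums
      (Gamma (of_real a) * Gamma (of_real b) * Gamma (of_real c - of_real a - of_real b)
        * rGamma (of_real c - of_real a) * rGamma (of_real c - of_real b :: complex))"
    using assms by (intro gauss_hyp2F1) auto
  also have "(\<lambda>k. gamma_quot (of_real a) 1 k * gamma_quot (of_real b) (of_real c) k :: complex) = (\<lambda>k. of_real (gamma_quot a 1 k * gamma_quot b c k))"
    using gamma_quot_of_real[of a 1] by (simp add: gamma_quot_of_real)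
  also have "Gamma (of_real a) * Gamma (of_real b) * Gamma (of_real c - of_real a - of_real b)
        * rGamma (of_real c - of_real a) * rGamma (of_real c - of_real b :: complex) =
      of_real (Gamma a * Gamma b * Gamma (c - a - b) * rGamma (c - a) * rGamma (c - b))"
    by (simp add: Gamma_complex_of_real rGamma_complex_of_real flip: of_real_diff)
  finally show ?thesis by (simp only: sums_of_real_iff)
qed

lemma summable_gamma_quot4_real:
  fixes a b c d e f g h :: real
  assumes "a > 0" "b > 0" "c > 0" "d > 0" "e > 0" "f > 0" "g > 0" "h > 0"
    and "e + f + g + h - a - b - c - d > 1"
  shows "summable (\<lambda>n. gamma_quot a e n * gamma_quot b f n * gamma_quot c g n * gamma_quot d h n)"
proof -
  have "summable (\<lambda>n. norm (gamma_quot (complex_of_real a) (of_real e) n * gamma_quot (complex_of_real b) (of_real f) n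
      * gamma_quot (complex_of_real c) (of_real g) n * gamma_quot (complex_of_real d) (of_real h) n))"
    using assms by (intro summable_gamma_quot4) auto
  thus ?thesis
    unfolding gamma_quot_of_real using assms by (simp add: norm_mult gamma_quot_real_pos abs_of_pos)
qed

text \<open>For fixed \<open>n\<close>, Gauss's theorem sums over \<open>m\<close> and produces the
  quotient of \<open>w - p - q + n\<close> against \<open>w - p + n\<close> and
  \<open>w - q + n\<close>; summing over \<open>n\<close> before \<open>m\<close> gives the left
  side.\<close>

lemma gamma_sum4_eq_sum_gamma_sum3:
  fixes a b c e p q w :: complex
  assumes pos: "Re a > 0" "Re b > 0" "Re c > 0" "Re e > 0" "Re p > 0" "Re q > 0" "Re w > 0"
    "Re (w - p - q) > 0" "Re (e + w - a - b - c) > 0"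
  shows "(\<lambda>m. gamma_quot p 1 m * Gamma (q + of_nat m) * gamma_sum3 a b c e (w + of_nat m)) sums
    (Gamma p * Gamma q * (\<Sum>n. gamma_quot a 1 n * gamma_quot b e n * gamma_quot c (w - p) n * gamma_quot (w - p - q) (w - q) n))"
proof -
  define f where "f = (\<lambda>n m. (gamma_quot a 1 n * gamma_quot b e n * Gamma (c + of_nat n)) *
      ((gamma_quot p 1 m * Gamma (q + of_nat m)) * rGamma (w + of_nat (n + m))))"
  define g where "g = (\<lambda>n m. (gamma_quot (Re a) 1 n * gamma_quot (Re b) (Re e) n * Gamma (Re c + real n)) *
      ((gamma_quot (Re p) 1 m * Gamma (Re q + real m)) * rGamma (Re w + real (n + m))))"
  define \<phi> where "\<phi> = (\<lambda>n. gamma_quot a 1 n * gamma_quot b e n * gamma_quot c (w - p) n * gamma_quot (w - p - q) (w - q) n)"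
  \<comment> \<open>The row sums of the majorant in closed form, again by Gauss's theorem; their
    summability is the excess condition for the real parts.\<close>
  define G where "G = (\<lambda>n. Gamma (Re p) * Gamma (Re q) * (gamma_quot (Re a) 1 n * gamma_quot (Re b) (Re e) n *
      gamma_quot (Re c) (Re w - Re p) n * gamma_quot (Re w - Re p - Re q) (Re w - Re q) n))"
  obtain C1 where C1: "\<And>n. norm (gamma_quot a 1 n) \<le> C1 * gamma_quot (Re a) 1 n"
    using norm_gamma_quot_le[of a 1] pos by auto
  obtain C2 where C2: "\<And>n. norm (gamma_quot b e n) \<le> C2 * gamma_quot (Re b) (Re e) n"
    using norm_gamma_quot_le[of b e] pos by auto
  obtain C3 where C3: "\<And>n. norm (Gamma (c + of_nat n)) \<le> C3 * Gamma (Re c + real n)"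
    using norm_Gamma_shift_le[of c] pos by auto
  obtain C4 where C4: "\<And>n. norm (gamma_quot p 1 n) \<le> C4 * gamma_quot (Re p) 1 n"
    using norm_gamma_quot_le[of p 1] pos by auto
  obtain C5 where C5: "\<And>n. norm (Gamma (q + of_nat n)) \<le> C5 * Gamma (Re q + real n)"
    using norm_Gamma_shift_le[of q] pos by auto
  obtain C6 where C6: "\<And>n. norm (rGamma (w + of_nat n)) \<le> C6 * rGamma (Re w + real n)"
    using norm_rGamma_shift_le[of w] pos by auto
  define C where "C = (C1 * C2 * C3) * ((C4 * C5) * C6)"
  have le: "norm (f n m) \<le> C * g n m" for n m
    unfolding f_def g_def C_def by (intro norm_mult_le C1 C2 C3 C4 C5 C6)
  have row: "f n sums (Gamma p * Gamma q * \<phi> n)" for n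
  proof -
    have "(\<lambda>m. (gamma_quot a 1 n * gamma_quot b e n * Gamma (c + of_nat n)) * (gamma_quot p 1 m * gamma_quot q (w + of_nat n) m)) sums
      ((gamma_quot a 1 n * gamma_quot b e n * Gamma (c + of_nat n)) * (Gamma p * Gamma q * Gamma (w + of_nat n - p - q)
        * rGamma (w + of_nat n - p) * rGamma (w + of_nat n - q)))"
      using pos by (intro sums_mult gauss_hyp2F1) auto
    moreover have "w + of_nat n - p - q = w - p - q + of_nat n" "w + of_nat n - p = w - p + of_nat n"
      "w + of_nat n - q = w - q + of_nat n"
      by simp_all
    ultimately show ?thesis
      by (simp only: f_def \<phi>_def gamma_quot_def mult_ac add_ac of_nat_add)
  qed
  have rowR: "g n sums G n" for n
  proof -
    have "(\<lambda>m. (gamma_quot (Re a) 1 n * gamma_quot (Re b) (Re e) n * Gamma (Re c + real n)) * (gamma_quot (Re p) 1 m * gamma_quot (Re q) (Re w + real n) m)) sums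
      ((gamma_quot (Re a) 1 n * gamma_quot (Re b) (Re e) n * Gamma (Re c + real n)) *
        (Gamma (Re p) * Gamma (Re q) * Gamma (Re w + real n - Re p - Re q)
        * rGamma (Re w + real n - Re p) * rGamma (Re w + real n - Re q)))"
      using pos by (intro sums_mult gauss_hyp2F1_real) auto
    moreover have "Re w + real n - Re p - Re q = Re w - Re p - Re q + real n" "Re w + real n - Re p = Re w - Re p + real n"
      "Re w + real n - Re q = Re w - Re q + real n"
      by simp_all
    ultimately show ?thesis
      by (simp only: g_def G_def gamma_quot_def mult_ac add_ac of_nat_add)
  qed
  have "summable G"
    unfolding G_def using pos by (intro summable_mult summable_gamma_quot4_real) auto
  hence sG: "summable (\<lambda>n. C * G n)" by (rule summable_mult)
  note sw = suminf_swap_dominated[of f "\<lambda>n m. C * g n m", OF le sums_mult[OF rowR] sG]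
  have col: "(\<Sum>n. f n m) = gamma_quot p 1 m * Gamma (q + of_nat m) * gamma_sum3 a b c e (w + of_nat m)" for m
  proof -
    have "f n m = gamma_quot p 1 m * Gamma (q + of_nat m) * (gamma_quot a 1 n * gamma_quot b e n * gamma_quot c (w + of_nat m) n)" for n
      by (simp add: f_def gamma_quot_def mult_ac add_ac)
    moreover have "summable (\<lambda>n. gamma_quot a 1 n * gamma_quot b e n * gamma_quot c (w + of_nat m) n)"
      using pos by (intro summable_gamma_sum3) (auto intro: add_pos_nonneg)
    ultimately show ?thesis unfolding gamma_sum3_def by (simp add: suminf_mult)
  qed
  have "summable \<phi>"
    unfolding \<phi>_def using pos by (intro summable_norm_cancel[OF summable_gamma_quot4]) auto
  hence "(\<Sum>n. \<Sum>m. f n m) = Gamma p * Gamma q * (\<Sum>n. \<phi> n)"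
    using row by (simp add: sums_iff suminf_mult)
  thus ?thesis
    using sw(2,3) unfolding col \<phi>_def by (simp add: sums_iff)
qed

text \<open>Up to the factor Gamma a Gamma b Gamma c Gamma d / (Gamma e Gamma f Gamma g) this is
  4F3(a, b, c, d; e, f, g; 1).\<close>

definition gamma_sum4 :: "complex \<Rightarrow> complex \<Rightarrow> complex \<Rightarrow> complex \<Rightarrow> complex \<Rightarrow> complex \<Rightarrow> complex \<Rightarrow> complex" where
  "gamma_sum4 a b c d e f g = (\<Sum>n. gamma_quot a 1 n * gamma_quot b e n * gamma_quot c f n * gamma_quot d g n)"

definition gamma_sum4_diff :: "complex \<Rightarrow> complex \<Rightarrow> complex \<Rightarrow> complex \<Rightarrow> complex \<Rightarrow> complex \<Rightarrow> complex \<Rightarrow> complex" where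
  "gamma_sum4_diff a b c d e f g = gamma_sum4 a b c d e f g
     - gamma_sum4 (1 + a - e) (1 + b - e) (1 + c - e) (1 + d - e) (2 - e) (1 + f - e) (1 + g - e)"

text \<open>A convenient open set on which all series below converge absolutely and no Gamma factor has a
  pole. The condition \<open>Re e < 1\<close> also keeps \<open>sin (\<pi> Re e)\<close> away from zero.\<close>

definition good_region :: "complex \<Rightarrow> complex \<Rightarrow> complex \<Rightarrow> complex \<Rightarrow> complex \<Rightarrow> complex \<Rightarrow> complex \<Rightarrow> bool" where
  "good_region a b c d e f g \<longleftrightarrow>
     e + f + g = 1 + a + b + c + d \<and>
     Re a > 0 \<and> Re b > 0 \<and> Re c > 0 \<and> Re d > 0 \<and>
     Re (1 + a - e) > 0 \<and> Re (1 + b - e) > 0 \<and> Re (1 + c - e) > 0 \<and> Re (1 + d - e) > 0 \<and>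
     Re e > 0 \<and> Re e < 1 \<and> Re (g - d) > 0 \<and> Re (f - d) > 0 \<and>
     Re (1 + a + b - e) > 0 \<and> Re (1 + a + b - e) < 1"

text \<open>The parameters \<open>g - d\<close>, \<open>f - d\<close> of the Gauss expansion are the
  same for both 4F3 sums; only \<open>y + c\<close> is replaced by \<open>y + (1 + c - e)\<close>.
  The two expansions can therefore be subtracted term by term, and each difference is
  \<open>gamma_sum3_difference_lift\<close> at \<open>s = c\<close>.\<close>

lemma gamma_sum4_diff_double_sum:
  assumes "good_region a b c d e f g" and y: "y = 1 + a + b - e"
  shows "(\<lambda>m. (sin (of_real pi * e) / of_real pi * Gamma (1 + a - e) * Gamma (1 + b - e) * Gamma c)
            * (gamma_quot (g - d) 1 m * gamma_quot (f - d) y m * gamma_sum3 a b (y + of_nat m) y (y + c + of_nat m)))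
     sums (Gamma (g - d) * Gamma (f - d) * gamma_sum4_diff a b c d e f g)"
proof -
  have rel: "e + f + g = 1 + a + b + c + d"
    and pos: "Re a > 0" "Re b > 0" "Re c > 0" "Re d > 0"
      "Re (1 + a - e) > 0" "Re (1 + b - e) > 0" "Re (1 + c - e) > 0" "Re (1 + d - e) > 0"
      "Re e > 0" "Re e < 1" "Re (g - d) > 0" "Re (f - d) > 0"
      "Re y > 0" "Re y < 1"
    using assms unfolding good_region_def by auto
  have eqs: "y + c - (g - d) = f" "y + c - (f - d) = g" "y + c - (g - d) - (f - d) = d"
    using rel unfolding y by algebra+
  define c' where "c' = 1 + c - e"
  have eqs': "y + c' - (g - d) = 1 + f - e" "y + c' - (f - d) = 1 + g - e" "1 + f - e - (f - d) = 1 + d - e"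
    using rel unfolding y c'_def by (algebra, algebra, simp)
  have "(\<lambda>m. gamma_quot (g - d) 1 m * Gamma (f - d + of_nat m) * gamma_sum3 a b c e (y + c + of_nat m)) sums
    (Gamma (g - d) * Gamma (f - d) * gamma_sum4 a b c d e f g)"
    unfolding gamma_sum4_def using gamma_sum4_eq_sum_gamma_sum3[of a b c e "g - d" "f - d" "y + c"] pos unfolding eqs
    by (simp add: y)
  moreover have "(\<lambda>m. gamma_quot (g - d) 1 m * Gamma (f - d + of_nat m) * gamma_sum3 (1 + a - e) (1 + b - e) c' (2 - e) (y + c' + of_nat m)) sums
    (Gamma (g - d) * Gamma (f - d) * gamma_sum4 (1 + a - e) (1 + b - e) (1 + c - e) (1 + d - e) (2 - e) (1 + f - e) (1 + g - e))"
    unfolding gamma_sum4_def c'_def[symmetric]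
    by (rule gamma_sum4_eq_sum_gamma_sum3[of "1 + a - e" "1 + b - e" c' "2 - e" "g - d" "f - d" "y + c'", unfolded eqs'])
       (use pos in \<open>auto simp: y c'_def\<close>)
  ultimately have "(\<lambda>m. gamma_quot (g - d) 1 m * Gamma (f - d + of_nat m) * gamma_sum3 a b c e (y + c + of_nat m) -
      gamma_quot (g - d) 1 m * Gamma (f - d + of_nat m) * gamma_sum3 (1 + a - e) (1 + b - e) c' (2 - e) (y + c' + of_nat m)) sums
    (Gamma (g - d) * Gamma (f - d) * gamma_sum4_diff a b c d e f g)"
    unfolding gamma_sum4_diff_def right_diff_distrib by (rule sums_diff)
  moreover have "gamma_quot (g - d) 1 m * Gamma (f - d + of_nat m) * gamma_sum3 a b c e (y + c + of_nat m) -
      gamma_quot (g - d) 1 m * Gamma (f - d + of_nat m) * gamma_sum3 (1 + a - e) (1 + b - e) c' (2 - e) (y + c' + of_nat m)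
     = (sin (of_real pi * e) / of_real pi * Gamma (1 + a - e) * Gamma (1 + b - e) * Gamma c)
            * (gamma_quot (g - d) 1 m * gamma_quot (f - d) y m * gamma_sum3 a b (y + of_nat m) y (y + c + of_nat m))" for m
  proof -
    define K where "K = sin (of_real pi * e) / of_real pi * Gamma (1 + a - e) * Gamma (1 + b - e)"
    define D where "D = gamma_sum3 a b c e (y + c + of_nat m) - gamma_sum3 (1 + a - e) (1 + b - e) c' (2 - e) (y + c' + of_nat m)"
    have "Gamma (y + of_nat m) * D = K * (Gamma c * gamma_sum3 a b (y + of_nat m) y (y + c + of_nat m))"
      using gamma_sum3_difference_lift[of a b e y c m] pos y unfolding K_def D_def c'_def by (simp add: add_ac)
    hence "rGamma (y + of_nat m) * (Gamma (y + of_nat m) * D) =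
        rGamma (y + of_nat m) * (K * (Gamma c * gamma_sum3 a b (y + of_nat m) y (y + c + of_nat m)))"
      by simp
    hence "D = rGamma (y + of_nat m) * (K * (Gamma c * gamma_sum3 a b (y + of_nat m) y (y + c + of_nat m)))"
      using Gamma_rGamma_Re[of "y + of_nat m"] pos
      by (simp add: mult.assoc[symmetric] mult.commute[of "rGamma _"] add_pos_nonneg)
    hence "gamma_quot (g - d) 1 m * Gamma (f - d + of_nat m) * D =
       (K * Gamma c) * (gamma_quot (g - d) 1 m * gamma_quot (f - d) y m * gamma_sum3 a b (y + of_nat m) y (y + c + of_nat m))"
      by (simp add: gamma_quot_def mult_ac)
    thus ?thesis by (simp add: D_def K_def right_diff_distrib)
  qed
  ultimately show ?thesis by simp
qed

lemma of_real_gamma_quot: "complex_of_real (gamma_quot x y n) = gamma_quot (of_real x) (of_real y) n"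
  by (simp add: gamma_quot_of_real)

text \<open>For real parameters all terms of the double series are positive, so absolute convergence comes
  for free from the iterated sum; the general case is dominated by the real one.\<close>

lemma double_sum_commute:
  assumes "good_region a b c d e f g" and y: "y = 1 + a + b - e"
  shows "(\<Sum>m. gamma_quot (g - d) 1 m * gamma_quot (f - d) y m * gamma_sum3 a b (y + of_nat m) y (y + c + of_nat m)) =
         (\<Sum>m. gamma_quot a 1 m * gamma_quot b y m * gamma_sum3 (g - d) (f - d) (y + of_nat m) y (y + c + of_nat m))"
proof -
  define p q where "p = g - d" "q = f - d"
  have rel: "e + f + g = 1 + a + b + c + d"
    and pos: "Re a > 0" "Re b > 0" "Re c > 0" "Re d > 0"
      "Re (1 + a - e) > 0" "Re (1 + b - e) > 0" "Re (1 + c - e) > 0" "Re (1 + d - e) > 0"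
      "Re e > 0" "Re e < 1" "Re p > 0" "Re q > 0"
      "Re y > 0" "Re y < 1"
    using assms unfolding good_region_def p_q_def by auto
  \<comment> \<open>By the balance condition the excess of the column sums is governed by
    \<open>Re d\<close> or \<open>Re (1 + d - e)\<close>, both positive in the region.\<close>
  have "y + c - p - q = d"
    using rel unfolding y p_q_def by algebra
  hence pq: "Re y + Re c - Re p - Re q > 0" "Re y + (1 + Re c - Re e) - Re p - Re q > 0"
    using pos by auto
  define v where "v = (\<lambda>m k. (gamma_quot p 1 m * gamma_quot q y m) * ((gamma_quot a 1 k * gamma_quot b y k) * gamma_quot y (y + c) (m + k)))"
  define vR where "vR = (\<lambda>m k. (gamma_quot (Re p) 1 m * gamma_quot (Re q) (Re y) m) * ((gamma_quot (Re a) 1 k * gamma_quot (Re b) (Re y) k) * gamma_quot (Re y) (Re y + Re c) (m + k)))"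
  have gamma_sum3_eq: "gamma_sum3 p q (y + of_nat m) y (y + c + of_nat m) = (\<Sum>k. gamma_quot p 1 k * gamma_quot q y k * gamma_quot y (y + c) (m + k))" for p q y c m
    unfolding gamma_sum3_def gamma_quot_shift ..
  have row_summable: "summable (\<lambda>k. gamma_quot p' 1 k * gamma_quot q' y' k * gamma_quot y' (y' + c') (m + k))"
    if "Re p' > 0" "Re q' > 0" "Re y' > 0" "Re c' > 0" "Re (y' + c' - p' - q') > 0" for p' q' y' c' m
    using summable_gamma_sum3[of p' q' "y' + of_nat m" y' "y' + c' + of_nat m"] that unfolding gamma_quot_shift by auto
  let ?r = "\<lambda>z. complex_of_real (Re z)"
  \<comment> \<open>Apart from the balance equation the region only constrains real parts, so it
    also contains the tuple of real parts.\<close>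
  have regR: "good_region (?r a) (?r b) (?r c) (?r d) (?r e) (?r f) (?r g)"
  proof -
    have "Re e + Re f + Re g = 1 + Re a + Re b + Re c + Re d" using arg_cong[OF rel, of Re] by simp
    hence "?r e + ?r f + ?r g = 1 + ?r a + ?r b + ?r c + ?r d"
      by (metis of_real_1 of_real_add)
    thus ?thesis using pos unfolding good_region_def y p_q_def by auto
  qed
  define GR where "GR = (\<lambda>m. (gamma_quot (Re p) 1 m * gamma_quot (Re q) (Re y) m) * (\<Sum>k. (gamma_quot (Re a) 1 k * gamma_quot (Re b) (Re y) k) * gamma_quot (Re y) (Re y + Re c) (m + k)))"
  have sumR: "summable (\<lambda>k. (gamma_quot (Re a) 1 k * gamma_quot (Re b) (Re y) k) * gamma_quot (Re y) (Re y + Re c) (m + k))" for m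
  proof -
    have "summable (\<lambda>k. gamma_quot (?r a) 1 k * gamma_quot (?r b) (?r y) k * gamma_quot (?r y) (?r y + ?r c) (m + k))"
      using pos by (intro row_summable) (auto simp: y)
    also have "(\<lambda>k. gamma_quot (?r a) 1 k * gamma_quot (?r b) (?r y) k * gamma_quot (?r y) (?r y + ?r c) (m + k)) =
        (\<lambda>k. of_real ((gamma_quot (Re a) 1 k * gamma_quot (Re b) (Re y) k) * gamma_quot (Re y) (Re y + Re c) (m + k)))"
      by (simp add: of_real_gamma_quot)
    finally show ?thesis using summable_Re by fastforce
  qed
  have rowR: "vR m sums GR m" for m
    unfolding vR_def GR_def by (intro sums_mult summable_sums sumR)
  have "summable GR"
  proof -
    have ry: "?r y = 1 + ?r a + ?r b - ?r e" by (simp add: y)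
    define K where "K = (sin (of_real pi * ?r e) / of_real pi * Gamma (1 + ?r a - ?r e) * Gamma (1 + ?r b - ?r e) * Gamma (?r c))"
    have "Re (sin (of_real pi * ?r e)) > 0"
      using pos sin_gt_zero[of "pi * Re e"] by (simp flip: of_real_mult sin_of_real)
    hence "K \<noteq> 0"
      using pos by (auto simp: K_def Gamma_nz_Re)
    \<comment> \<open>For real parameters the terms of the convergent series in
      \<open>gamma_sum4_diff_double_sum\<close> are \<open>K\<close> times the row sums
      \<open>GR\<close> of the majorant.\<close>
    have "summable (\<lambda>m. K * (gamma_quot (?r g - ?r d) 1 m * gamma_quot (?r f - ?r d) (?r y) m *
        gamma_sum3 (?r a) (?r b) (?r y + of_nat m) (?r y) (?r y + ?r c + of_nat m)))"
      using gamma_sum4_diff_double_sum[OF regR ry] unfolding K_def by (rule sums_summable)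
    hence "summable (\<lambda>m. gamma_quot (?r g - ?r d) 1 m * gamma_quot (?r f - ?r d) (?r y) m *
        gamma_sum3 (?r a) (?r b) (?r y + of_nat m) (?r y) (?r y + ?r c + of_nat m))"
      using \<open>K \<noteq> 0\<close> by (simp only: summable_cmult_iff simp_thms)
    also have "(\<lambda>m. gamma_quot (?r g - ?r d) 1 m * gamma_quot (?r f - ?r d) (?r y) m *
        gamma_sum3 (?r a) (?r b) (?r y + of_nat m) (?r y) (?r y + ?r c + of_nat m)) = (\<lambda>m. of_real (GR m))"
      unfolding gamma_sum3_eq GR_def of_real_mult suminf_of_real[OF sumR] of_real_gamma_quot
      by (simp add: p_q_def)
    finally show ?thesis using summable_Re by fastforce
  qed
  obtain C1 where C1: "\<And>n. norm (gamma_quot p 1 n) \<le> C1 * gamma_quot (Re p) 1 n"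
    using norm_gamma_quot_le[of p 1] pos by auto
  obtain C2 where C2: "\<And>n. norm (gamma_quot q y n) \<le> C2 * gamma_quot (Re q) (Re y) n"
    using norm_gamma_quot_le[of q y] pos by auto
  obtain C3 where C3: "\<And>n. norm (gamma_quot a 1 n) \<le> C3 * gamma_quot (Re a) 1 n"
    using norm_gamma_quot_le[of a 1] pos by auto
  obtain C4 where C4: "\<And>n. norm (gamma_quot b y n) \<le> C4 * gamma_quot (Re b) (Re y) n"
    using norm_gamma_quot_le[of b y] pos by auto
  obtain C5 where C5: "\<And>n. norm (gamma_quot y (y + c) n) \<le> C5 * gamma_quot (Re y) (Re y + Re c) n"
    using norm_gamma_quot_le[of y "y + c"] pos by auto
  define C where "C = (C1 * C2) * ((C3 * C4) * C5)"
  have le: "norm (v m k) \<le> C * vR m k" for m k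
    unfolding v_def vR_def C_def by (intro norm_mult_le C1 C2 C3 C4 C5)
  note sw = suminf_swap_dominated[of v "\<lambda>m k. C * vR m k", OF le sums_mult[OF rowR] summable_mult[OF \<open>summable GR\<close>]]
  have 1: "(\<Sum>k. v m k) = gamma_quot p 1 m * gamma_quot q y m * gamma_sum3 a b (y + of_nat m) y (y + c + of_nat m)" for m
    unfolding v_def gamma_sum3_eq using pos by (intro suminf_mult row_summable) (auto simp: y)
  have 2: "(\<Sum>m. v m k) = gamma_quot a 1 k * gamma_quot b y k * gamma_sum3 p q (y + of_nat k) y (y + c + of_nat k)" for k
  proof -
    have "v m k = gamma_quot a 1 k * gamma_quot b y k * (gamma_quot p 1 m * gamma_quot q y m * gamma_quot y (y + c) (k + m))" for m
      by (simp add: v_def mult_ac add.commute)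
    moreover have "summable (\<lambda>m. gamma_quot p 1 m * gamma_quot q y m * gamma_quot y (y + c) (k + m))"
      using pos pq by (intro row_summable) auto
    ultimately show ?thesis unfolding gamma_sum3_eq by (simp add: suminf_mult)
  qed
  show ?thesis
    using sw(3) unfolding 1 2 p_q_def .
qed

text \<open>For the second tuple the roles of \<open>g - d\<close> and \<open>f - d\<close> are
  played by \<open>a\<close> and \<open>b\<close>, while \<open>y\<close> and \<open>c\<close> keep
  their values. Its double series is therefore the first one with the order of summation
  exchanged.\<close>

lemma gamma_sum4_diff_transform:
  assumes 1: "good_region a b c d e f g"
    and 2: "good_region (g - d) (f - d) c (1 + c - e) (1 + c - d) (f + g - d - a) (f + g - d - b)"
  shows "Gamma a * Gamma b * gamma_sum4_diff (g - d) (f - d) c (1 + c - e) (1 + c - d) (f + g - d - a) (f + g - d - b)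
      * (sin (of_real pi * e) * Gamma (1 + a - e) * Gamma (1 + b - e)) =
     Gamma (g - d) * Gamma (f - d) * gamma_sum4_diff a b c d e f g
      * (sin (of_real pi * (1 + c - d)) * Gamma (1 + (g - d) - (1 + c - d)) * Gamma (1 + (f - d) - (1 + c - d)))"
proof -
  define y where "y = 1 + a + b - e"
  have rel: "e + f + g = 1 + a + b + c + d" using 1 by (simp add: good_region_def)
  have y2: "y = 1 + (g - d) + (f - d) - (1 + c - d)"
    using rel unfolding y_def by algebra
  have eqs: "f + g - d - b - (1 + c - e) = a" "f + g - d - a - (1 + c - e) = b"
    using rel by algebra+
  define K1 where "K1 = sin (of_real pi * e) / of_real pi * Gamma (1 + a - e) * Gamma (1 + b - e) * Gamma c"
  define K2 where "K2 = sin (of_real pi * (1 + c - d)) / of_real pi * Gamma (1 + (g - d) - (1 + c - d)) * Gamma (1 + (f - d) - (1 + c - d)) * Gamma c"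
  define E1 where "E1 = (\<lambda>m. gamma_quot (g - d) 1 m * gamma_quot (f - d) y m * gamma_sum3 a b (y + of_nat m) y (y + c + of_nat m))"
  define E2 where "E2 = (\<lambda>m. gamma_quot a 1 m * gamma_quot b y m * gamma_sum3 (g - d) (f - d) (y + of_nat m) y (y + c + of_nat m))"
  define Q1 where "Q1 = gamma_sum4_diff a b c d e f g"
  define Q2 where "Q2 = gamma_sum4_diff (g - d) (f - d) c (1 + c - e) (1 + c - d) (f + g - d - a) (f + g - d - b)"
  have s1: "(\<lambda>m. K1 * E1 m) sums (Gamma (g - d) * Gamma (f - d) * Q1)"
    using gamma_sum4_diff_double_sum[OF 1 y_def] unfolding K1_def E1_def Q1_def .
  have s2: "(\<lambda>m. K2 * E2 m) sums (Gamma a * Gamma b * Q2)"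
    using gamma_sum4_diff_double_sum[OF 2 y2] unfolding K2_def E2_def Q2_def eqs .
  have E: "suminf E1 = suminf E2"
    using double_sum_commute[OF 1 y_def] by (simp add: E1_def E2_def)
  have "K2 * (Gamma (g - d) * Gamma (f - d) * Q1) = K1 * (Gamma a * Gamma b * Q2)"
  \<comment> \<open>If one constant vanishes, its series is zero term by term, hence so is the value
    of that series, and both sides are 0.\<close>
  proof (cases "K1 = 0 \<or> K2 = 0")
    case True
    thus ?thesis using s1 s2 by (auto simp: sums_iff)
  next
    case False
    have "suminf E1 = (Gamma (g - d) * Gamma (f - d) * Q1) / K1"
      using s1 False sums_mult_D[of K1 E1] sums_unique by metis
    moreover have "suminf E2 = (Gamma a * Gamma b * Q2) / K2"
      using s2 False sums_mult_D[of K2 E2] sums_unique by metis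
    ultimately show ?thesis using E False by (simp add: field_simps)
  qed
  moreover have "Gamma c \<noteq> 0" using 1 by (intro Gamma_nz_Re) (auto simp: good_region_def)
  ultimately have "sin (of_real pi * (1 + c - d)) * Gamma (1 + (g - d) - (1 + c - d)) * Gamma (1 + (f - d) - (1 + c - d)) * (Gamma (g - d) * Gamma (f - d) * Q1)
     = sin (of_real pi * e) * Gamma (1 + a - e) * Gamma (1 + b - e) * (Gamma a * Gamma b * Q2)"
    unfolding K1_def K2_def by (simp add: field_simps)
  thus ?thesis unfolding Q1_def Q2_def by (simp only: mult_ac)
qed

section \<open>Holomorphic dependence on the parameters\<close>

text \<open>Pochhammer symbols above and \<open>rGamma\<close> below make every term entire in all
  seven parameters, whereas \<open>gamma_quot\<close> has poles.\<close>

definition reg_term :: "complex \<Rightarrow> complex \<Rightarrow> complex \<Rightarrow> complex \<Rightarrow> complex \<Rightarrow> complex \<Rightarrow> complex \<Rightarrow> nat \<Rightarrow> complex" where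
  "reg_term a b c d e f g n =
     pochhammer a n * pochhammer b n * pochhammer c n * pochhammer d n
       * (rGamma (e + of_nat n) * rGamma (f + of_nat n) * rGamma (g + of_nat n)) / fact n"

definition reg4F3 :: "complex \<Rightarrow> complex \<Rightarrow> complex \<Rightarrow> complex \<Rightarrow> complex \<Rightarrow> complex \<Rightarrow> complex \<Rightarrow> complex" where
  "reg4F3 a b c d e f g = (\<Sum>n. reg_term a b c d e f g n)"

text \<open>This is \<open>sin (\<pi> e) * L\<close> wherever \<open>L\<close> is defined, but it is entire in the parameters.\<close>

definition L_reg :: "complex \<Rightarrow> complex \<Rightarrow> complex \<Rightarrow> complex \<Rightarrow> complex \<Rightarrow> complex \<Rightarrow> complex \<Rightarrow> complex" where
  "L_reg a b c d e f g =
     reg4F3 a b c d e f g * (rGamma (1 + a - e) * rGamma (1 + b - e) * rGamma (1 + c - e) * rGamma (1 + d - e))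
     - reg4F3 (1 + a - e) (1 + b - e) (1 + c - e) (1 + d - e) (1 + f - e) (1 + g - e) (2 - e)
         * (rGamma a * rGamma b * rGamma c * rGamma d)"

text \<open>The ratio of consecutive terms, cross-multiplied because \<open>e + of_nat n\<close>,
  \<open>f + of_nat n\<close> or \<open>g + of_nat n\<close> may be 0.\<close>

lemma reg_term_Suc:
  "(of_nat n + 1) * ((e + of_nat n) * (f + of_nat n) * (g + of_nat n)) * reg_term a b c d e f g (Suc n) =
   (a + of_nat n) * (b + of_nat n) * (c + of_nat n) * (d + of_nat n) * reg_term a b c d e f g n"
proof -
  define N :: complex where "N = of_nat n"
  have r': "rGamma (z + N) = (z + N) * rGamma (z + of_nat (Suc n))" for z
    using rGamma_plus1[of "z + N"] by (simp add: N_def add_ac)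
  have fct: "(fact (Suc n) :: complex) = (N + 1) * fact n" by (simp add: N_def algebra_simps)
  have nz: "N + 1 \<noteq> 0"
    unfolding N_def by (metis of_nat_Suc of_nat_eq_0_iff nat.distinct(1) add.commute)
  have "M * (x * y * z) * (pa * p * (pb * q) * (pc * r) * (pd * s) * (E * F * G) / (M * h)) =
      p * q * r * s * (pa * pb * pc * pd * ((x * E) * (y * F) * (z * G)) / h)" if "M \<noteq> 0"
    for M x y z pa pb pc pd p q r s E F G h :: complex
    using that by (simp add: divide_inverse mult_ac)
  from this[OF nz] show ?thesis
    unfolding reg_term_def pochhammer_Suc fct N_def[symmetric] r' .
qed

text \<open>Here \<open>N\<close> and \<open>D\<close> bound \<open>(a+n)(b+n)(c+n)(d+n)\<close> and \<open>(e+n)(f+n)(g+n)\<close>, and \<open>X\<close> stands for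
  \<open>\<bar>n + a + b + c + d\<bar>\<close>. The excess \<open>1\<close> leaves room for comparing the terms with
  \<open>\<Gamma>(1+n) / \<Gamma>(5/2+n)\<close>, which is of order \<open>n\<close> to the power \<open>-3/2\<close>.\<close>

lemma ratio_bound_aux:
  fixes n X K K' N D :: real
  assumes "n \<ge> 1" "K \<ge> 0" "K' \<ge> 0" "n \<ge> 14 * K + 16 * K'" "X \<ge> n / 2"
    and N: "N \<le> n ^ 3 * X + K * n ^ 2" and D: "D \<ge> n * (n + 1) * X - K' * n"
  shows "N * (n + 5 / 2) \<le> (n + 1)\<^sup>2 * D"
proof -
  have "(n + 1)\<^sup>2 * D - N * (n + 5 / 2) \<ge> (n + 1)\<^sup>2 * (n * (n + 1) * X - K' * n) - (n ^ 3 * X + K * n ^ 2) * (n + 5 / 2)"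
    using assms(1) by (intro diff_mono mult_left_mono mult_right_mono N D) auto
  also have "(n + 1)\<^sup>2 * (n * (n + 1) * X - K' * n) - (n ^ 3 * X + K * n ^ 2) * (n + 5 / 2)
     = X * (n ^ 3 / 2 + 3 * n ^ 2 + n) - K * (n ^ 2 * (n + 5 / 2)) - K' * (n * (n + 1)\<^sup>2)"
    by (simp add: power2_eq_square power3_eq_cube algebra_simps)
  finally have 1: "(n + 1)\<^sup>2 * D - N * (n + 5 / 2) \<ge> X * (n ^ 3 / 2 + 3 * n ^ 2 + n) - K * (n ^ 2 * (n + 5 / 2)) - K' * (n * (n + 1)\<^sup>2)" .
  \<comment> \<open>For \<open>n\<close> at least 1, the bounds \<open>n + 5/2 <= 7/2 * n\<close>
    and \<open>(n + 1)^2 <= (2 * n)^2\<close> reduce the claim to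
    \<open>n / 4 >= 7/2 * K + 4 * K'\<close>; this is the origin of 14 and 16.\<close>
  have "n / 2 * (n ^ 3 / 2) \<le> X * (n ^ 3 / 2 + 3 * n ^ 2 + n)"
    using assms(1,5) by (intro mult_mono) auto
  moreover have "K * (n ^ 2 * (n + 5 / 2)) \<le> K * (n ^ 2 * (7 / 2 * n))"
    using assms(1,2) by (intro mult_left_mono) auto
  moreover have "K' * (n * (n + 1)\<^sup>2) \<le> K' * (n * (2 * n)\<^sup>2)"
    using assms(1,3) by (intro mult_left_mono power_mono) auto
  moreover have "0 \<le> n ^ 3 * (n / 4 - 7 / 2 * K - 4 * K')"
    using assms(1,4) by (intro mult_nonneg_nonneg) auto
  ultimately show ?thesis
    using 1 by (simp add: power2_eq_square power3_eq_cube algebra_simps)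
qed

lemma bounded_on_cball:
  fixes f :: "complex \<Rightarrow> complex"
  assumes "continuous_on UNIV f"
  obtains B where "B \<ge> 0" "\<And>y. y \<in> cball x 1 \<Longrightarrow> norm (f y) \<le> B"
proof -
  have "bounded (f ` cball x 1)"
    using assms by (intro compact_imp_bounded compact_continuous_image) (auto intro: continuous_on_subset)
  then obtain B where "\<forall>y\<in>f ` cball x 1. norm y \<le> B" by (auto simp: bounded_iff)
  thus ?thesis using that[of "max B 0"] by force
qed

text \<open>Entire families in one complex variable are enough: the identity is continued along a
  line, and constant families give summability at a single point.\<close>

context
  fixes a b c d e f g :: "complex \<Rightarrow> complex"
  assumes hol: "a holomorphic_on UNIV" "b holomorphic_on UNIV" "c holomorphic_on UNIV" "d holomorphic_on UNIV"
    "e holomorphic_on UNIV" "f holomorphic_on UNIV" "g holomorphic_on UNIV"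
    and rel: "\<And>z. e z + f z + g z = 1 + a z + b z + c z + d z"
begin

private definition t where "t n z = reg_term (a z) (b z) (c z) (d z) (e z) (f z) (g z) n"

private lemma holomorphic_t: "t n holomorphic_on UNIV"
  unfolding t_def [abs_def] reg_term_def pochhammer_prod by (intro holomorphic_intros hol) auto

text \<open>As polynomials in \<open>n\<close>, numerator and denominator of the term ratio are
  \<open>n^3 * (n + s)\<close> and \<open>n * (n + 1) * (n + s)\<close> up to lower order, the
  latter because \<open>e + f + g = 1 + s\<close>. The remaining coefficients are continuous in
  \<open>z\<close>, so the bound is uniform on a closed disc.\<close>

private lemma t_ratio_bound:
  obtains N where "N \<ge> 1" "\<And>n y. n \<ge> N \<Longrightarrow> y \<in> cball x 1 \<Longrightarrow> norm (t (Suc n) y) * (real n + 5 / 2) \<le> norm (t n y) * (real n + 1)"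
proof -
  note cont = hol[THEN holomorphic_on_imp_continuous_on]
  define s where "s = (\<lambda>z. a z + b z + c z + d z)"
  define k2 where "k2 = (\<lambda>z. a z * b z + a z * c z + a z * d z + b z * c z + b z * d z + c z * d z)"
  define k3 where "k3 = (\<lambda>z. a z * b z * c z + a z * b z * d z + a z * c z * d z + b z * c z * d z)"
  define k4 where "k4 = (\<lambda>z. a z * b z * c z * d z)"
  define l1 where "l1 = (\<lambda>z. e z * f z + e z * g z + f z * g z - s z)"
  define l2 where "l2 = (\<lambda>z. e z * f z * g z)"
  have cs: "continuous_on UNIV s" "continuous_on UNIV k2" "continuous_on UNIV k3" "continuous_on UNIV k4"
    "continuous_on UNIV l1" "continuous_on UNIV l2"
    unfolding s_def k2_def k3_def k4_def l1_def l2_def by (intro continuous_intros cont)+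
  obtain S where S: "S \<ge> 0" "\<And>y. y \<in> cball x 1 \<Longrightarrow> norm (s y) \<le> S" using bounded_on_cball[OF cs(1), of x] by blast
  obtain K2 where K2: "K2 \<ge> 0" "\<And>y. y \<in> cball x 1 \<Longrightarrow> norm (k2 y) \<le> K2" using bounded_on_cball[OF cs(2), of x] by blast
  obtain K3 where K3: "K3 \<ge> 0" "\<And>y. y \<in> cball x 1 \<Longrightarrow> norm (k3 y) \<le> K3" using bounded_on_cball[OF cs(3), of x] by blast
  obtain K4 where K4: "K4 \<ge> 0" "\<And>y. y \<in> cball x 1 \<Longrightarrow> norm (k4 y) \<le> K4" using bounded_on_cball[OF cs(4), of x] by blast
  obtain L1 where L1: "L1 \<ge> 0" "\<And>y. y \<in> cball x 1 \<Longrightarrow> norm (l1 y) \<le> L1" using bounded_on_cball[OF cs(5), of x] by blast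
  obtain L2 where L2: "L2 \<ge> 0" "\<And>y. y \<in> cball x 1 \<Longrightarrow> norm (l2 y) \<le> L2" using bounded_on_cball[OF cs(6), of x] by blast
  define K K' where "K = K2 + K3 + K4" "K' = L1 + L2"
  \<comment> \<open>\<open>2 * S\<close> guarantees |n + s| >= n / 2, and the rest is the threshold
    of \<open>ratio_bound_aux\<close>.\<close>
  define N where "N = nat \<lceil>1 + 2 * S + 14 * K + 16 * K'\<rceil>"
  have KK: "K \<ge> 0" "K' \<ge> 0" using K2 K3 K4 L1 L2 by (auto simp: K_K'_def)
  show ?thesis
  proof (rule that)
    show "N \<ge> 1" using S KK unfolding N_def by linarith
    fix n y assume n: "n \<ge> N" and y: "y \<in> cball x 1"
    let ?n = "of_nat n :: complex"
    define num where "num = (a y + ?n) * (b y + ?n) * (c y + ?n) * (d y + ?n)"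
    define den where "den = (e y + ?n) * (f y + ?n) * (g y + ?n)"
    define X where "X = norm (?n + s y)"
    have n_ge: "real n \<ge> 1 + 2 * S + 14 * K + 16 * K'"
      using n unfolding N_def by linarith
    hence n1: "real n \<ge> 1" using S KK by linarith
    have Xn: "X \<ge> real n / 2"
      using norm_triangle_ineq4[of "?n + s y" "s y"] S(2)[OF y] n_ge KK unfolding X_def by simp
    have num: "num = ?n ^ 3 * (?n + s y) + (k2 y * ?n ^ 2 + k3 y * ?n + k4 y)"
      unfolding num_def s_def k2_def k3_def k4_def
      by (simp add: power2_eq_square power3_eq_cube algebra_simps)
    have den: "?n * (?n + 1) * (?n + s y) = den - (l1 y * ?n + l2 y)"
    proof -
      have sy: "s y = e y + f y + g y - 1"
        using rel[of y] by (simp add: s_def)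
      show ?thesis
        unfolding den_def l1_def l2_def sy by (simp add: algebra_simps)
    qed
    have "norm (k2 y * ?n ^ 2 + k3 y * ?n + k4 y) \<le> K2 * real n ^ 2 + K3 * real n ^ 2 + K4 * real n ^ 2"
    proof (intro norm_triangle_mono)
      show "norm (k2 y * ?n ^ 2) \<le> K2 * real n ^ 2"
        unfolding norm_mult norm_power norm_of_nat by (intro mult_right_mono K2 y) auto
      show "norm (k3 y * ?n) \<le> K3 * real n ^ 2"
        unfolding norm_mult norm_of_nat using n1 K3 by (intro mult_mono K3 y) (auto simp: power2_eq_square)
      have "norm (k4 y) * 1 \<le> K4 * real n ^ 2"
        using n1 K4 by (intro mult_mono K4 y) (auto simp: one_le_power)
      thus "norm (k4 y) \<le> K4 * real n ^ 2" by simp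
    qed
    also have "\<dots> = K * real n ^ 2" by (simp add: K_K'_def algebra_simps)
    finally have num_le: "norm num \<le> real n ^ 3 * X + K * real n ^ 2"
      unfolding num X_def by (intro norm_triangle_mono) (simp_all add: norm_mult norm_power)
    have "norm (l1 y * ?n + l2 y) \<le> L1 * real n + L2 * real n"
    proof (intro norm_triangle_mono)
      show "norm (l1 y * ?n) \<le> L1 * real n"
        unfolding norm_mult norm_of_nat by (intro mult_right_mono L1 y) auto
      have "norm (l2 y) * 1 \<le> L2 * real n"
        using n1 L2 by (intro mult_mono L2 y) auto
      thus "norm (l2 y) \<le> L2 * real n" by simp
    qed
    hence "norm (den - (l1 y * ?n + l2 y)) \<le> norm den + K' * real n"
      using norm_triangle_ineq4[of den "l1 y * ?n + l2 y"] by (simp add: K_K'_def algebra_simps)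
    moreover have norm_n1: "norm (?n + 1) = real n + 1"
      by (metis norm_of_nat of_nat_1 of_nat_add)
    ultimately have den_ge: "norm den \<ge> real n * (real n + 1) * X - K' * real n"
      unfolding den[symmetric] X_def by (simp add: norm_mult)
    have le: "norm num * (real n + 5 / 2) \<le> (real n + 1)\<^sup>2 * norm den"
      using ratio_bound_aux[OF n1 KK _ Xn num_le den_ge] n_ge S by simp
    have "real n * (real n + 1) * X - K' * real n = real n * ((real n + 1) * X - K')"
      by (simp add: algebra_simps)
    also have "(real n + 1) * X \<ge> 1 * (real n / 2)"
      using n1 Xn by (intro mult_mono) auto
    hence "(real n + 1) * X - K' > 0" using n_ge S KK n1 by linarith
    hence "real n * ((real n + 1) * X - K') > 0" using n1 by simp
    finally have den_pos: "norm den > 0" using den_ge by linarith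
    have "norm ((?n + 1) * den * t (Suc n) y) = norm (num * t n y)"
      unfolding num_def den_def t_def by (rule arg_cong[OF reg_term_Suc])
    hence "(real n + 1) * norm den * norm (t (Suc n) y) = norm num * norm (t n y)"
      unfolding norm_mult norm_n1 .
    hence "(real n + 1) * norm den * (norm (t (Suc n) y) * (real n + 5 / 2)) = (norm num * (real n + 5 / 2)) * norm (t n y)"
      by (simp only: mult.assoc[symmetric]) (simp only: mult.commute mult.left_commute mult.assoc)
    also have "\<dots> \<le> ((real n + 1)\<^sup>2 * norm den) * norm (t n y)"
      by (intro mult_right_mono le) auto
    also have "\<dots> = (real n + 1) * norm den * (norm (t n y) * (real n + 1))"
      by (simp add: power2_eq_square)
    finally show "norm (t (Suc n) y) * (real n + 5 / 2) \<le> norm (t n y) * (real n + 1)"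
      using den_pos by (simp add: mult_le_cancel_left_pos)
  qed
qed

text \<open>The comparison sequence satisfies the ratio bound with equality, so the bound propagates
  by induction from index \<open>N\<close>.\<close>

private lemma t_bound:
  obtains N B where "\<And>n y. n \<ge> N \<Longrightarrow> y \<in> cball x 1 \<Longrightarrow> norm (t n y) \<le> B * gamma_quot 1 (5/2) n" "B \<ge> 0"
proof -
  obtain N where N: "N \<ge> 1" "\<And>n y. n \<ge> N \<Longrightarrow> y \<in> cball x 1 \<Longrightarrow> norm (t (Suc n) y) * (real n + 5 / 2) \<le> norm (t n y) * (real n + 1)"
    using t_ratio_bound[of x] by blast
  obtain B where B: "B \<ge> 0" "\<And>y. y \<in> cball x 1 \<Longrightarrow> norm (t N y) \<le> B"
    using bounded_on_cball[OF holomorphic_on_imp_continuous_on[OF holomorphic_t]] by blast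
  define w :: "nat \<Rightarrow> real" where "w = gamma_quot 1 (5/2)"
  have w_pos: "w n > 0" for n unfolding w_def by (rule gamma_quot_real_pos) auto
  have w_Suc: "(real n + 5 / 2) * w (Suc n) = (real n + 1) * w n" for n
  proof -
    have "1 + real n \<notin> \<int>\<^sub>\<le>\<^sub>0" by (auto elim!: nonpos_Ints_cases)
    hence "Gamma (1 + real (Suc n)) = (1 + real n) * Gamma (1 + real n)"
      using Gamma_plus1[of "1 + real n"] by (simp add: add_ac)
    moreover have "(5/2 + real n) * rGamma (5/2 + real (Suc n)) = rGamma (5/2 + real n)"
      using rGamma_plus1[of "5/2 + real n"] by (simp add: add_ac)
    ultimately show ?thesis
      unfolding w_def gamma_quot_def by (simp add: add.commute mult_ac)
  qed
  have "norm (t n y) \<le> (B / w N) * w n" if "n \<ge> N" "y \<in> cball x 1" for n y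
    using that(1)
  proof (induction rule: dec_induct)
    case base
    thus ?case using B(2)[OF that(2)] w_pos[of N] by simp
  next
    case (step n)
    have "norm (t (Suc n) y) * (real n + 5 / 2) \<le> norm (t n y) * (real n + 1)"
      using step that by (intro N) auto
    also have "\<dots> \<le> ((B / w N) * w n) * (real n + 1)"
      by (intro mult_right_mono step.IH) auto
    also have "\<dots> = ((B / w N) * w (Suc n)) * (real n + 5 / 2)"
      using w_Suc[of n] by (simp add: mult_ac)
    finally show ?case by (rule mult_right_le_imp_le) auto
  qed
  moreover have "B / w N \<ge> 0" using B(1) w_pos[of N] by simp
  ultimately show ?thesis using that unfolding w_def by blast
qed

private lemma summable_w: "summable (\<lambda>n. gamma_quot 1 (5/2) n :: real)"
proof -
  have "(\<lambda>n. norm (gamma_quot 1 (5/2) n :: complex)) \<in> O(\<lambda>n. real n powr (Re 1 - Re (5/2)))"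
    by (intro gamma_quot_bigo) auto
  moreover have "norm (gamma_quot 1 (5/2) n :: complex) = gamma_quot 1 (5/2) n" for n
    using gamma_quot_of_real[of 1 "5/2" n] gamma_quot_real_pos[of 1 "5/2" n] by simp
  ultimately have "(\<lambda>n. gamma_quot 1 (5/2) n :: real) \<in> O(\<lambda>n. real n powr (-3/2))" by simp
  thus ?thesis
    by (rule summable_comparison_test_bigo[rotated]) (simp add: summable_real_powr_iff)
qed

lemma reg4F3_holomorphic: "(\<lambda>z. reg4F3 (a z) (b z) (c z) (d z) (e z) (f z) (g z)) holomorphic_on UNIV"
  and reg_term_summable: "summable (reg_term (a z) (b z) (c z) (d z) (e z) (f z) (g z))"
proof -
  have bd: "\<exists>D h. 0 < D \<and> summable h \<and> range h \<subseteq> \<real>\<^sub>\<ge>\<^sub>0 \<and>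
      (\<forall>\<^sub>F n in sequentially. \<forall>y\<in>ball x D \<inter> UNIV. cmod (t n y) \<le> cmod (h n))" for x
  proof -
    obtain N B where NB: "\<And>n y. n \<ge> N \<Longrightarrow> y \<in> cball x 1 \<Longrightarrow> norm (t n y) \<le> B * gamma_quot 1 (5/2) n" "B \<ge> 0"
      using t_bound[of x] by blast
    have nonneg: "B * gamma_quot 1 (5/2) n \<ge> 0" for n
      using NB(2) gamma_quot_real_pos[of 1 "5/2" n] by simp
    show ?thesis
    proof (intro exI conjI)
      show "summable (\<lambda>n. complex_of_real (B * gamma_quot 1 (5/2) n))"
        by (intro summable_of_real summable_mult summable_w)
      show "range (\<lambda>n. complex_of_real (B * gamma_quot 1 (5/2) n)) \<subseteq> \<real>\<^sub>\<ge>\<^sub>0"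
        using nonneg by (auto simp del: of_real_mult)
      show "\<forall>\<^sub>F n in sequentially. \<forall>y\<in>ball x 1 \<inter> UNIV. cmod (t n y) \<le> cmod (complex_of_real (B * gamma_quot 1 (5/2) n))"
        unfolding norm_of_real abs_of_nonneg[OF nonneg] eventually_sequentially
        using NB(1) by (intro exI[of _ N]) auto
    qed auto
  qed
  have fd: "t n field_differentiable (at x)" for n x
    using holomorphic_t by (simp add: holomorphic_on_def)
  obtain G where G: "\<forall>x\<in>UNIV. ((\<lambda>n. t n x) sums G x) \<and> G field_differentiable (at x)"
    using series_differentiable_comparison_complex[of UNIV t, OF open_UNIV fd bd] by blast
  have "(\<lambda>z. reg4F3 (a z) (b z) (c z) (d z) (e z) (f z) (g z)) = G"
    using G by (auto simp: reg4F3_def t_def sums_iff fun_eq_iff)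
  thus "(\<lambda>z. reg4F3 (a z) (b z) (c z) (d z) (e z) (f z) (g z)) holomorphic_on UNIV"
    using G by (simp add: holomorphic_on_def)
  show "summable (reg_term (a z) (b z) (c z) (d z) (e z) (f z) (g z))"
    using G by (auto simp: t_def sums_iff)
qed

end

section \<open>The transformation\<close>

lemma reg4F3_eq_gamma_sum4:
  assumes "Re a > 0" "Re b > 0" "Re c > 0" "Re d > 0" "Re e > 0" "Re f > 0" "Re g > 0"
    and "e + f + g = 1 + a + b + c + d"
  shows "reg4F3 a b c d e f g = rGamma a * rGamma b * rGamma c * rGamma d * gamma_sum4 a b c d e f g"
proof -
  have P: "pochhammer z n = rGamma z * Gamma (z + of_nat n)" if "Re z > 0" for z n
  proof -
    have "rGamma z * Gamma (z + of_nat n) = (Gamma z * rGamma z) * pochhammer z n"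
      unfolding Gamma_shift_eq[OF that] by (simp only: mult_ac)
    thus ?thesis unfolding Gamma_rGamma_Re[OF that] by simp
  qed
  have "reg_term a b c d e f g n =
      rGamma a * rGamma b * rGamma c * rGamma d * (gamma_quot a 1 n * gamma_quot b e n * gamma_quot c f n * gamma_quot d g n)" for n
  proof -
    have "rGamma (1 + of_nat n :: complex) = 1 / fact n"
      by (simp add: rGamma_inverse_Gamma Gamma_fact divide_inverse)
    thus ?thesis
      unfolding reg_term_def gamma_quot_def P[OF assms(1)] P[OF assms(2)] P[OF assms(3)] P[OF assms(4)] by simp
  qed
  hence eq: "reg_term a b c d e f g =
      (\<lambda>n. rGamma a * rGamma b * rGamma c * rGamma d * (gamma_quot a 1 n * gamma_quot b e n * gamma_quot c f n * gamma_quot d g n))"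
    by blast
  have "Re e + Re f + Re g = 1 + Re a + Re b + Re c + Re d"
    using arg_cong[OF assms(8), of Re] by simp
  hence "summable (\<lambda>n. gamma_quot a 1 n * gamma_quot b e n * gamma_quot c f n * gamma_quot d g n)"
    using assms by (intro summable_norm_cancel[OF summable_gamma_quot4]) auto
  thus ?thesis
    unfolding reg4F3_def gamma_sum4_def eq by (rule suminf_mult)
qed

lemma reg4F3_perm:
  "reg4F3 a b c d e f g = reg4F3 b a c d e f g" "reg4F3 a b c d e f g = reg4F3 a b d c e f g"
  "reg4F3 a b c d e f g = reg4F3 a c b d e f g"
  "reg4F3 a b c d e f g = reg4F3 a b c d e g f" "reg4F3 a b c d e f g = reg4F3 a b c d f e g"
  unfolding reg4F3_def reg_term_def by (simp_all add: mult_ac)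

lemma L_reg_eq:
  assumes "good_region a b c d e f g"
  shows "L_reg a b c d e f g = rGamma a * rGamma b * rGamma c * rGamma d
    * (rGamma (1 + a - e) * rGamma (1 + b - e) * rGamma (1 + c - e) * rGamma (1 + d - e)) * gamma_sum4_diff a b c d e f g"
proof -
  have rel: "e + f + g = 1 + a + b + c + d"
    and pos: "Re a > 0" "Re b > 0" "Re c > 0" "Re d > 0"
      "Re (1 + a - e) > 0" "Re (1 + b - e) > 0" "Re (1 + c - e) > 0" "Re (1 + d - e) > 0"
      "Re e > 0" "Re e < 1" "Re (g - d) > 0" "Re (f - d) > 0"
    using assms unfolding good_region_def by auto
  have 1: "reg4F3 a b c d e f g = rGamma a * rGamma b * rGamma c * rGamma d * gamma_sum4 a b c d e f g"
    using pos rel by (intro reg4F3_eq_gamma_sum4) auto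
  have "reg4F3 (1 + a - e) (1 + b - e) (1 + c - e) (1 + d - e) (2 - e) (1 + f - e) (1 + g - e) =
      rGamma (1 + a - e) * rGamma (1 + b - e) * rGamma (1 + c - e) * rGamma (1 + d - e)
        * gamma_sum4 (1 + a - e) (1 + b - e) (1 + c - e) (1 + d - e) (2 - e) (1 + f - e) (1 + g - e)"
  proof (rule reg4F3_eq_gamma_sum4)
    show "2 - e + (1 + f - e) + (1 + g - e) = 1 + (1 + a - e) + (1 + b - e) + (1 + c - e) + (1 + d - e)"
      using rel by algebra
  qed (use pos in auto)
  moreover have "reg4F3 (1 + a - e) (1 + b - e) (1 + c - e) (1 + d - e) (1 + f - e) (1 + g - e) (2 - e) =
      reg4F3 (1 + a - e) (1 + b - e) (1 + c - e) (1 + d - e) (2 - e) (1 + f - e) (1 + g - e)"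
    by (rule trans[OF reg4F3_perm(4) reg4F3_perm(5)])
  ultimately show ?thesis
    unfolding L_reg_def gamma_sum4_diff_def 1 by (simp add: right_diff_distrib mult_ac)
qed

text \<open>By \<open>L_reg_eq\<close> both sides carry the \<open>rGamma\<close> factors of
  \<open>c\<close>, \<open>d\<close>, \<open>1 + c - e\<close> and \<open>1 + d - e\<close>. The
  remaining four on each side match the Gamma factors in
  \<open>gamma_sum4_diff_transform\<close>.\<close>

lemma L_reg_transform:
  assumes 1: "good_region a b c d e f g"
    and 2: "good_region (g - d) (f - d) c (1 + c - e) (1 + c - d) (f + g - d - a) (f + g - d - b)"
  shows "L_reg (g - d) (f - d) c (1 + c - e) (1 + c - d) (f + g - d - a) (f + g - d - b) * sin (of_real pi * e)
     = L_reg a b c d e f g * sin (of_real pi * (1 + c - d))"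
proof -
  define p q h where "p = g - d" "q = f - d" "h = 1 + c - d"
  define Q1 where "Q1 = gamma_sum4_diff a b c d e f g"
  define Q2 where "Q2 = gamma_sum4_diff p q c (1 + c - e) h (f + g - d - a) (f + g - d - b)"
  have h: "1 + c - h = d" "1 + (1 + c - e) - h = 1 + d - e"
    by (simp_all add: p_q_h_def)
  have T: "Gamma a * Gamma b * Q2 * (sin (of_real pi * e) * Gamma (1 + a - e) * Gamma (1 + b - e)) =
     Gamma p * Gamma q * Q1 * (sin (of_real pi * h) * Gamma (1 + p - h) * Gamma (1 + q - h))"
    using gamma_sum4_diff_transform[OF 1 2] unfolding Q1_def Q2_def p_q_h_def .
  have L1: "L_reg a b c d e f g = rGamma a * rGamma b * rGamma c * rGamma d
    * (rGamma (1 + a - e) * rGamma (1 + b - e) * rGamma (1 + c - e) * rGamma (1 + d - e)) * Q1"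
    unfolding Q1_def by (rule L_reg_eq[OF 1])
  have L2: "L_reg p q c (1 + c - e) h (f + g - d - a) (f + g - d - b) =
    rGamma p * rGamma q * rGamma c * rGamma (1 + c - e)
    * (rGamma (1 + p - h) * rGamma (1 + q - h) * rGamma d * rGamma (1 + d - e)) * Q2"
    using L_reg_eq[OF 2] unfolding Q2_def p_q_h_def[symmetric] h .
  have nz: "Gamma a \<noteq> 0" "Gamma b \<noteq> 0" "Gamma (1 + a - e) \<noteq> 0" "Gamma (1 + b - e) \<noteq> 0"
    "Gamma p \<noteq> 0" "Gamma q \<noteq> 0" "Gamma (1 + p - h) \<noteq> 0" "Gamma (1 + q - h) \<noteq> 0"
    using 1 2 unfolding good_region_def p_q_h_def by (auto intro!: Gamma_nz_Re)
  define R where "R = rGamma c * rGamma d * rGamma (1 + c - e) * rGamma (1 + d - e)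
      * rGamma a * rGamma b * rGamma (1 + a - e) * rGamma (1 + b - e)
      * rGamma p * rGamma q * rGamma (1 + p - h) * rGamma (1 + q - h)"
  have G: "Gamma z * rGamma z = 1" if "Gamma z \<noteq> 0" for z :: complex
    using that by (simp add: rGamma_inverse_Gamma)
  have "L_reg p q c (1 + c - e) h (f + g - d - a) (f + g - d - b) * sin (of_real pi * e) =
      (Gamma a * Gamma b * Q2 * (sin (of_real pi * e) * Gamma (1 + a - e) * Gamma (1 + b - e))) * R"
    unfolding L2 R_def using nz by (simp add: rGamma_inverse_Gamma field_simps)
  also have "\<dots> = L_reg a b c d e f g * sin (of_real pi * h)"
    unfolding T L1 R_def using nz by (simp add: rGamma_inverse_Gamma field_simps)
  finally show ?thesis unfolding p_q_h_def .
qed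

lemma L_reg_perm:
  "L_reg a b c d e f g = L_reg b a c d e f g" "L_reg a b c d e f g = L_reg a b d c e f g"
  "L_reg a b c d e f g = L_reg a c b d e f g" "L_reg a b c d e f g = L_reg a b c d e g f"
proof -
  show "L_reg a b c d e f g = L_reg b a c d e f g"
    unfolding L_reg_def reg4F3_perm(1)[of a b] reg4F3_perm(1)[of "1 + a - e" "1 + b - e"] by (simp only: mult_ac)
  show "L_reg a b c d e f g = L_reg a b d c e f g"
    unfolding L_reg_def reg4F3_perm(2)[of a b c d] reg4F3_perm(2)[of "1 + a - e" "1 + b - e" "1 + c - e" "1 + d - e"]
    by (simp only: mult_ac)
  show "L_reg a b c d e f g = L_reg a c b d e f g"
    unfolding L_reg_def reg4F3_perm(3)[of a b c d] reg4F3_perm(3)[of "1 + a - e" "1 + b - e" "1 + c - e" "1 + d - e"]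
    by (simp only: mult_ac)
  show "L_reg a b c d e f g = L_reg a b c d e g f"
    unfolding L_reg_def reg4F3_perm(4)[of a b c d e f g]
      reg4F3_perm(5)[of "1 + a - e" "1 + b - e" "1 + c - e" "1 + d - e" "1 + f - e" "1 + g - e"]
    by simp
qed

text \<open>Moving \<open>f - d\<close> and \<open>c\<close> into the first two slots before the
  second application prevents it from undoing the first; it restores \<open>a\<close> and
  \<open>b\<close> and replaces the other parameters. The intermediate sine of \<open>pi * h\<close>
  occurs once on each side and cancels.\<close>

lemma L_reg_transform_twice:
  assumes 1: "good_region a b c d e f g"
    and 2: "good_region (g - d) (f - d) c (1 + c - e) (1 + c - d) (f + g - d - a) (f + g - d - b)"
    and 3: "good_region (f - d) c (g - d) (1 + c - e) (1 + c - d) (f + g - d - a) (f + g - d - b)"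
    and 4: "good_region a b (g - d) (g - c) (1 + a + b - f) g (1 + a + b - e)"
  shows "L_reg a b (g - c) (g - d) (1 + a + b - f) (1 + a + b - e) g * sin (of_real pi * e)
       = L_reg a b c d e f g * sin (of_real pi * (1 + a + b - f))"
proof -
  have rel: "e + f + g = 1 + a + b + c + d" using 1 by (simp add: good_region_def)
  define F G where "F = f + g - d - a" "G = f + g - d - b"
  define h where "h = 1 + c - d"
  have eqs: "G - (1 + c - e) = a" "F - (1 + c - e) = b" "1 + (g - d) - h = g - c"
    "1 + (g - d) - (1 + c - e) = 1 + a + b - f" "F + G - (1 + c - e) - (f - d) = g"
    "F + G - (1 + c - e) - c = 1 + a + b - e"
    using rel unfolding F_G_def h_def by (algebra, algebra, simp, algebra+)
  have A: "L_reg (g - d) (f - d) c (1 + c - e) h F G * sin (of_real pi * e) =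
      L_reg a b c d e f g * sin (of_real pi * h)"
    using L_reg_transform[OF 1 2] unfolding F_G_def h_def .
  have B: "L_reg a b (g - d) (g - c) (1 + a + b - f) g (1 + a + b - e) * sin (of_real pi * h) =
      L_reg (f - d) c (g - d) (1 + c - e) h F G * sin (of_real pi * (1 + a + b - f))"
    using L_reg_transform[of "f - d" c "g - d" "1 + c - e" h F G] 3 4 unfolding F_G_def[symmetric] h_def[symmetric] eqs
    by simp
  have C: "L_reg (f - d) c (g - d) (1 + c - e) h F G = L_reg (g - d) (f - d) c (1 + c - e) h F G"
    by (rule trans[OF L_reg_perm(3) L_reg_perm(1)])
  have D: "L_reg a b (g - d) (g - c) (1 + a + b - f) g (1 + a + b - e) = L_reg a b (g - c) (g - d) (1 + a + b - f) (1 + a + b - e) g"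
    by (rule trans[OF L_reg_perm(2) L_reg_perm(4)])
  \<comment> \<open>\<open>h\<close> is the fifth parameter of the second tuple, whose region
    confines it to the open strip.\<close>
  have "Re h > 0" "Re h < 1" using 2 unfolding good_region_def h_def by auto
  hence "h \<notin> \<int>" by (auto elim!: Ints_cases)
  hence "sin (of_real pi * h) \<noteq> 0" using sin_eq_0[of "of_real pi * h"] by (auto simp: mult.commute)
  moreover have "(L_reg a b (g - c) (g - d) (1 + a + b - f) (1 + a + b - e) g * sin (of_real pi * e)) * sin (of_real pi * h) =
     (L_reg a b c d e f g * sin (of_real pi * (1 + a + b - f))) * sin (of_real pi * h)"
    using A B unfolding C D by algebra
  ultimately show ?thesis by simp
qed

section \<open>Analytic continuation along complex lines\<close>

lemma L_reg_holomorphic: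
  assumes "a holomorphic_on UNIV" "b holomorphic_on UNIV" "c holomorphic_on UNIV" "d holomorphic_on UNIV"
    "e holomorphic_on UNIV" "f holomorphic_on UNIV" "g holomorphic_on UNIV"
    and rel: "\<And>z. e z + f z + g z = 1 + a z + b z + c z + d z"
  shows "(\<lambda>z. L_reg (a z) (b z) (c z) (d z) (e z) (f z) (g z)) holomorphic_on UNIV"
proof -
  have "1 + f z - e z + (1 + g z - e z) + (2 - e z) = 1 + (1 + a z - e z) + (1 + b z - e z) + (1 + c z - e z) + (1 + d z - e z)" for z
    using rel[of z] by algebra
  thus ?thesis
    unfolding L_reg_def by (intro holomorphic_intros reg4F3_holomorphic assms) auto
qed

text \<open>The region contains an equation and is not open by itself. Along a family inside the
  hyperplane the equation holds identically, and only strict inequalities remain.\<close>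

lemma open_good_region:
  assumes cont: "continuous_on UNIV a" "continuous_on UNIV b" "continuous_on UNIV c" "continuous_on UNIV d"
    "continuous_on UNIV e" "continuous_on UNIV f" "continuous_on UNIV g"
    and rel: "\<And>z::complex. e z + f z + g z = 1 + a z + b z + c z + d z"
  shows "open {z. good_region (a z) (b z) (c z) (d z) (e z) (f z) (g z)}"
  unfolding good_region_def using rel
  by (auto intro!: open_Collect_conj open_Collect_less continuous_intros cont)

theorem L_reg_transform_global:
  assumes rel: "e + f + g = 1 + a + b + c + d"
  shows "L_reg a b (g - c) (g - d) (1 + a + b - f) (1 + a + b - e) g * sin (of_real pi * e)
       = L_reg a b c d e f g * sin (of_real pi * (1 + a + b - f))"
proof -
  define A where "A = (\<lambda>z. 1/5 + z * (a - 1/5))"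
  define B where "B = (\<lambda>z. 1/5 + z * (b - 1/5))"
  define C where "C = (\<lambda>z. 1/5 + z * (c - 1/5))"
  define D where "D = (\<lambda>z. 3/10 + z * (d - 3/10))"
  define E where "E = (\<lambda>z. 9/10 + z * (e - 9/10))"
  define F where "F = (\<lambda>z. 1/2 + z * (f - 1/2))"
  define G where "G = (\<lambda>z. 1/2 + z * (g - 1/2))"
  note defs = A_def B_def C_def D_def E_def F_def G_def
  have hol: "A holomorphic_on UNIV" "B holomorphic_on UNIV" "C holomorphic_on UNIV" "D holomorphic_on UNIV"
    "E holomorphic_on UNIV" "F holomorphic_on UNIV" "G holomorphic_on UNIV"
    unfolding defs by (intro holomorphic_intros)+
  note cont = hol[THEN holomorphic_on_imp_continuous_on]
  have relz: "E z + F z + G z = 1 + A z + B z + C z + D z" for z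
  proof -
    \<comment> \<open>An affine combination of two points of the hyperplane stays in it; the base
      point is kept symbolic until its numerals are inserted.\<close>
    have "e0 + z * (e - e0) + (f0 + z * (f - f0)) + (g0 + z * (g - g0)) =
        1 + (a0 + z * (a - a0)) + (b0 + z * (b - b0)) + (c0 + z * (c - c0)) + (d0 + z * (d - d0))"
      if "e0 + f0 + g0 = 1 + a0 + b0 + c0 + d0" for a0 b0 c0 d0 e0 f0 g0
      using that rel by algebra
    note line = this
    show ?thesis unfolding defs by (rule line) simp
  qed
  define l r where
    "l = (\<lambda>z. L_reg (A z) (B z) (G z - C z) (G z - D z) (1 + A z + B z - F z) (1 + A z + B z - E z) (G z)
      * sin (of_real pi * E z))"
    "r = (\<lambda>z. L_reg (A z) (B z) (C z) (D z) (E z) (F z) (G z) * sin (of_real pi * (1 + A z + B z - F z)))"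
  define S where "S = {z. good_region (A z) (B z) (C z) (D z) (E z) (F z) (G z)} \<inter>
     {z. good_region (G z - D z) (F z - D z) (C z) (1 + C z - E z) (1 + C z - D z) (F z + G z - D z - A z) (F z + G z - D z - B z)} \<inter>
     {z. good_region (F z - D z) (C z) (G z - D z) (1 + C z - E z) (1 + C z - D z) (F z + G z - D z - A z) (F z + G z - D z - B z)} \<inter>
     {z. good_region (A z) (B z) (G z - D z) (G z - C z) (1 + A z + B z - F z) (G z) (1 + A z + B z - E z)}"
  have S_open: "open S"
    unfolding S_def
  proof (intro open_Int open_good_region)
    fix z
    show "1 + C z - D z + (F z + G z - D z - A z) + (F z + G z - D z - B z) = 1 + (G z - D z) + (F z - D z) + C z + (1 + C z - E z)"
      using relz[of z] by algebra
    show "1 + C z - D z + (F z + G z - D z - A z) + (F z + G z - D z - B z) = 1 + (F z - D z) + C z + (G z - D z) + (1 + C z - E z)"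
      using relz[of z] by algebra
    show "1 + A z + B z - F z + G z + (1 + A z + B z - E z) = 1 + A z + B z + (G z - D z) + (G z - C z)"
      using relz[of z] by algebra
  qed (intro continuous_intros cont relz)+
  have "0 \<in> S"
    by (simp add: S_def good_region_def defs)
  hence S_ne: "S \<noteq> {}" by auto
  have l_hol: "l holomorphic_on UNIV"
    unfolding l_r_def
  proof (intro holomorphic_intros L_reg_holomorphic hol)
    fix z
    show "1 + A z + B z - F z + (1 + A z + B z - E z) + G z = 1 + A z + B z + (G z - C z) + (G z - D z)"
      using relz[of z] by algebra
  qed
  have r_hol: "r holomorphic_on UNIV"
    unfolding l_r_def
    by (intro holomorphic_intros L_reg_holomorphic hol relz)
  have "l z = r z" if "z \<in> S" for z
    unfolding l_r_def using that by (intro L_reg_transform_twice) (simp_all add: S_def)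
  hence "l 1 = r 1"
    by (rule analytic_continuation_open[OF S_open open_UNIV S_ne connected_UNIV subset_UNIV l_hol r_hol _ UNIV_I])
  moreover have "A 1 = a" "B 1 = b" "C 1 = c" "D 1 = d" "E 1 = e" "F 1 = f" "G 1 = g"
    by (simp_all add: defs)
  ultimately show ?thesis by (simp only: l_r_def)
qed

section \<open>Return from the entire function to the original one\<close>

lemma hyp4F3_reg:
  assumes "e \<notin> \<int>\<^sub>\<le>\<^sub>0" "f \<notin> \<int>\<^sub>\<le>\<^sub>0" "g \<notin> \<int>\<^sub>\<le>\<^sub>0" and rel: "e + f + g = 1 + a + b + c + d"
  shows "hyp4F3 a b c d e f g * (rGamma e * rGamma f * rGamma g) = reg4F3 a b c d e f g"
proof -
  define R where "R = rGamma e * rGamma f * rGamma g"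
  have R: "R \<noteq> 0" using assms by (simp add: R_def rGamma_eq_zero_iff)
  have r: "rGamma (z + of_nat n) = rGamma z / pochhammer z n" if "z \<notin> \<int>\<^sub>\<le>\<^sub>0" for z :: complex and n
    using pochhammer_rGamma[of z n] that pochhammer_eq_0_imp_nonpos_Int[of z n] by auto
  have "reg_term a b c d e f g n = R * ((pochhammer a n * pochhammer b n * pochhammer c n * pochhammer d n) /
         (fact n * pochhammer e n * pochhammer f n * pochhammer g n))" for n
    unfolding reg_term_def R_def r[OF assms(1)] r[OF assms(2)] r[OF assms(3)] by (simp add: divide_inverse mult_ac)
  hence eq: "reg_term a b c d e f g = (\<lambda>n. R * ((pochhammer a n * pochhammer b n * pochhammer c n * pochhammer d n) /
         (fact n * pochhammer e n * pochhammer f n * pochhammer g n)))" by auto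
  have "summable (reg_term a b c d e f g)"
    using reg_term_summable[of "\<lambda>_. a" "\<lambda>_. b" "\<lambda>_. c" "\<lambda>_. d" "\<lambda>_. e" "\<lambda>_. f" "\<lambda>_. g"] rel
    by (simp add: holomorphic_on_const)
  hence "summable (\<lambda>n. (pochhammer a n * pochhammer b n * pochhammer c n * pochhammer d n) /
         (fact n * pochhammer e n * pochhammer f n * pochhammer g n))"
    unfolding eq using R by (simp only: summable_cmult_iff simp_thms)
  thus ?thesis
    unfolding reg4F3_def eq hyp4F3_def R_def[symmetric] by (simp only: suminf_mult mult.commute)
qed

lemma L_eq_L_reg:
  assumes "L_defined e f g" and rel: "e + f + g = 1 + a + b + c + d"
  shows "L a b c d e f g = L_reg a b c d e f g / sin (of_real pi * e)"
proof -
  have e: "e \<notin> \<int>" and ok: "f \<notin> \<int>\<^sub>\<le>\<^sub>0" "g \<notin> \<int>\<^sub>\<le>\<^sub>0" "1 + f - e \<notin> \<int>\<^sub>\<le>\<^sub>0" "1 + g - e \<notin> \<int>\<^sub>\<le>\<^sub>0"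
    using assms(1) by (auto simp: L_defined_def)
  have e1: "e \<notin> \<int>\<^sub>\<le>\<^sub>0" using e nonpos_Ints_Int by blast
  have e2: "2 - e \<notin> \<int>\<^sub>\<le>\<^sub>0"
  proof
    assume "2 - e \<in> \<int>\<^sub>\<le>\<^sub>0"
    hence "2 - (2 - e) \<in> \<int>" using nonpos_Ints_Int by (intro Ints_diff) auto
    with e show False by simp
  qed
  have rel': "1 + f - e + (1 + g - e) + (2 - e) = 1 + (1 + a - e) + (1 + b - e) + (1 + c - e) + (1 + d - e)"
    using rel by algebra
  show ?thesis
    unfolding L_def L_reg_def hyp4F3_reg[OF e1 ok(1,2) rel, symmetric] hyp4F3_reg[OF ok(3,4) e2 rel', symmetric]
    by (simp add: diff_divide_distrib mult_ac)
qed

theorem proposition3p3: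
  fixes a b c d e f g :: complex
  assumes "e + f + g - a - b - c - d = 1"
    and "L_defined e f g"
    and "L_defined (1 + a + b - f) (1 + a + b - e) g"
  shows "L a b c d e f g = L a b (g - c) (g - d) (1 + a + b - f) (1 + a + b - e) g"
proof -
  have rel: "e + f + g = 1 + a + b + c + d" using assms(1) by (simp add: algebra_simps)
  have rel': "1 + a + b - f + (1 + a + b - e) + g = 1 + a + b + (g - c) + (g - d)"
    using rel by algebra
  have sin_nz: "sin (of_real pi * z) \<noteq> 0" if "z \<notin> \<int>" for z :: complex
    using that sin_eq_0[of "of_real pi * z"] by (auto simp: mult.commute)
  have "sin (of_real pi * e) \<noteq> 0" "sin (of_real pi * (1 + a + b - f)) \<noteq> 0"
    using assms(2,3) by (auto simp: L_defined_def intro!: sin_nz)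
  thus ?thesis
    unfolding L_eq_L_reg[OF assms(2) rel] L_eq_L_reg[OF assms(3) rel']
    using L_reg_transform_global[OF rel] by (simp add: field_simps)
qed

end
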